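(* Let $g\in H^\infty$ be such that $\widehat g(n)\ge0$ for all $n\in\mathbb N\cup\{0\}$, and let $X_1\in\{H^1,\,D^1_0,\,HL_1\}$. Then $T_g:X_1\to H^\infty$ is bounded if and only if $$\sup_{k\in\mathbb N\cup\{0\}}\left((k+1)\sum_{n=0}^{\infty}\frac{(n+1)\widehat g(n+1)}{n+k+1}\right)<\infty .$$ Moreover, $$\|T_g\|_{X_1\to H^\infty}\asymp\sup_{k\in\mathbb N\cup\{0\}}\left((k+1)\sum_{n=0}^{\infty}\frac{(n+1)\widehat g(n+1)}{n+k+1}\right),$$ where the comparison constants are independent of $g$.
   Context: $\mathbb D=\{z\in\mathbb C:|z|<1\}$ and $\mathcal H(\mathbb D)$ is the space of analytic functions in $\mathbb D$. For $f\in\mathcal H(\mathbb D)$, $\widehat f(n)$ denotes the $n$-th Maclaurin coefficient. For $g\in\mathcal H(\mathbb D)$, $T_g(f)(z)=\int_0^z f(\zeta)g'(\zeta)\,d\zeta$, $z\in\mathbb D$. $H^1$ and $H^\infty$ are the Hardy spaces of $\mathbb D$, with $\|f\|_{H^1}=\sup_{0<r<1}\frac1{2\pi}\int_0^{2\pi}|f(re^{i\theta})|\,d\theta$ and $\|f\|_{H^\infty}=\sup_{z\in\mathbb D}|f(z)|$. $D^1_0$ is the space of $f\in\mathcal H(\mathbb D)$ with $\|f\|_{D^1_0}=\int_{\mathbb D}|f'(z)|\,dA(z)+|f(0)|<\infty$, where $dA=\frac{dx\,dy}{\pi}$. $HL_1$ is the space of $f\in\mathcal H(\mathbb D)$ with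 $\|f\|_{HL_1}=\sum_{n=0}^\infty\frac{|\widehat f(n)|}{n+1}<\infty$. $\|T_g\|_{X\to H^\infty}$ is the operator norm ($+\infty$ if $T_g:X\to H^\infty$ is not bounded). $a\asymp b$ means $C^{-1}b\le a\le Cb$ for a constant $C>0$. *)

theory Defs
  imports "HOL-Complex_Analysis.Complex_Analysis"
begin

definition maclaurin_coeff :: "(complex \<Rightarrow> complex) \<Rightarrow> nat \<Rightarrow> complex" where
  "maclaurin_coeff f n = (deriv ^^ n) f 0 / fact n"

definition T_op :: "(complex \<Rightarrow> complex) \<Rightarrow> (complex \<Rightarrow> complex) \<Rightarrow> complex \<Rightarrow> complex" where
  "T_op g f z = contour_integral (linepath 0 z) (\<lambda>\<zeta>. f \<zeta> * deriv g \<zeta>)"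

text \<open>
  A space of analytic functions on the unit disc is given by its extended norm, with values in
  \<^typ>\<open>ennreal\<close>; its elements are the analytic functions of finite norm. Elements are total
  functions on \<^typ>\<open>complex\<close>, but only their values in the disc matter.
\<close>

definition analytic_space :: "((complex \<Rightarrow> complex) \<Rightarrow> ennreal) \<Rightarrow> (complex \<Rightarrow> complex) set" where
  "analytic_space N = {f. f holomorphic_on ball 0 1 \<and> N f < \<infinity>}"

definition Hinf_norm :: "(complex \<Rightarrow> complex) \<Rightarrow> ennreal" where
  "Hinf_norm f = (SUP z\<in>ball 0 1. ennreal (cmod (f z)))"

definition H1_norm :: "(complex \<Rightarrow> complex) \<Rightarrow> ennreal" where
  "H1_norm f = (SUP r\<in>{0<..<1}. ennreal (1 / (2 * pi)) *
     (\<integral>\<^sup>+\<theta>\<in>{0..2 * pi}. ennreal (cmod (f (of_real r * cis \<theta>))) \<partial>lborel))"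

definition D10_norm :: "(complex \<Rightarrow> complex) \<Rightarrow> ennreal" where
  "D10_norm f = ennreal (1 / pi) * (\<integral>\<^sup>+z\<in>ball 0 1. ennreal (cmod (deriv f z)) \<partial>lborel)
     + ennreal (cmod (f 0))"

definition HL1_norm :: "(complex \<Rightarrow> complex) \<Rightarrow> ennreal" where
  "HL1_norm f = (\<Sum>n. ennreal (cmod (maclaurin_coeff f n) / (real n + 1)))"

definition bounded_operator ::
  "((complex \<Rightarrow> complex) \<Rightarrow> ennreal) \<Rightarrow> ((complex \<Rightarrow> complex) \<Rightarrow> ennreal) \<Rightarrow>
   ((complex \<Rightarrow> complex) \<Rightarrow> complex \<Rightarrow> complex) \<Rightarrow> bool" where
  "bounded_operator N M T \<longleftrightarrow>
     (\<forall>f\<in>analytic_space N. T f \<in> analytic_space M) \<and>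
     (\<exists>C::real. \<forall>f\<in>analytic_space N. M (T f) \<le> ennreal C * N f)"

definition operator_norm ::
  "((complex \<Rightarrow> complex) \<Rightarrow> ennreal) \<Rightarrow> ((complex \<Rightarrow> complex) \<Rightarrow> ennreal) \<Rightarrow>
   ((complex \<Rightarrow> complex) \<Rightarrow> complex \<Rightarrow> complex) \<Rightarrow> ennreal" where
  "operator_norm N M T =
     (if bounded_operator N M T
      then SUP f\<in>{f\<in>analytic_space N. N f \<le> 1}. M (T f) else \<infinity>)"

text \<open>
  The real part below is harmless: the quantity is used only for \<open>g\<close> with nonnegative real
  coefficients. The inner series is taken in \<^typ>\<open>ennreal\<close>, so it is \<open>\<infinity>\<close> when divergent.
\<close>

definition coeff_sup :: "(complex \<Rightarrow> complex) \<Rightarrow> ennreal" where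
  "coeff_sup g = (SUP k::nat. ennreal (real k + 1) *
     (\<Sum>n. ennreal ((real n + 1) * Re (maclaurin_coeff g (n + 1)) / (real n + real k + 1))))"

end

theory Submission
  imports Defs
begin

text \<open>
  Let \<open>b n = (n + 1) * g_hat (n + 1)\<close> be the Maclaurin coefficients of \<open>g'\<close>. Integrating the Cauchy
  product \<open>f * g'\<close> term by term shows that \<open>\<bar>T_g f\<bar>\<close> is at most the sum over \<open>j\<close> of
  \<open>\<bar>f_hat j\<bar> * (\<Sum>n. b n / (n + j + 1))\<close>, hence at most \<open>coeff_sup g * HL1_norm f\<close>; when \<open>f\<close> has nonnegative
  coefficients this sum is exactly the supremum norm. The upper bound for the three spaces follows
  because each of their norms dominates the \<open>HL1\<close> norm. For \<open>H1\<close> this is Hardy's inequality: factor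
  a polynomial as \<open>u * v\<close> with \<open>\<bar>u\<bar> = \<bar>v\<bar>\<close> on the circle and apply Hilbert's inequality and Parseval's
  identity to \<open>u\<close> and \<open>v\<close>. For \<open>D10\<close>, integrate Hardy's inequality for \<open>f'\<close> over all circles. For the
  lower bound, \<open>(1 - \<rho>)\<^sup>2 / (1 - \<rho> * z)\<^sup>3\<close> with \<open>1 - \<rho>\<close> of order \<open>1 / (k + 1)\<close> is bounded in all three
  norms, and its first \<open>k + 1\<close> coefficients are nonnegative with sum of order \<open>k + 1\<close>.
\<close>

section \<open>Maclaurin coefficients and Parseval's identity\<close>

text \<open>The obstacle in Hardy's inequality is a zero on the circle, where the factorization
  breaks down. The n-th Taylor polynomial is therefore estimated on a zero-free circle of its own,
  slightly larger than the target circle, and degree and radius pass to the limit together. Since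
  both factors have equal modulus, their square means coincide with the mean of the polynomial's
  modulus; so Hilbert's inequality in the additive form, 2 * (sum of squares + sum of squares),
  loses nothing against the product form and gives Hardy's constant 2 + 2 = 4. On the disc,
  averaging over rotations replaces polar coordinates. The third power in the test function reduces
  both of its norm estimates to Parseval: on circles one factor is bounded pointwise and a square
  remains; on the disc the derivative is a fourth power, the squared modulus of an analytic
  function. The lower bound uses that the sum over n of b n / (n + j + 1) decreases in j, so for j
  up to k it is at least its value at k. Rearrangements of series and integrals take place in
  \<open>ennreal\<close>, where nonnegativity alone justifies them.\<close>

lemma maclaurin_coeff_sums:
  assumes "f holomorphic_on ball 0 r" "cmod z < r"
  shows "(\<lambda>n. maclaurin_coeff f n * z ^ n) sums f z"
  using holomorphic_power_series[OF assms(1), of z] assms(2) by (simp add: maclaurin_coeff_def)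

lemma maclaurin_coeff_conv_fps_expansion: "maclaurin_coeff f n = fps_nth (fps_expansion f 0) n"
  by (simp add: maclaurin_coeff_def fps_expansion_def)

lemma maclaurin_coeff_0: "maclaurin_coeff f 0 = f 0"
  by (simp add: maclaurin_coeff_def)

lemma maclaurin_coeff_eqI:
  assumes r: "r > 0" and s: "\<And>z. cmod z < r \<Longrightarrow> (\<lambda>n. a n * z ^ n) sums f z"
  shows "maclaurin_coeff f n = a n"
proof -
  have "f has_fps_expansion Abs_fps a"
  proof (rule has_fps_expansionI)
    have "eventually (\<lambda>z. z \<in> ball 0 r) (nhds (0::complex))"
      using r by (intro eventually_nhds_in_open) auto
    then show "eventually (\<lambda>u. (\<lambda>n. fps_nth (Abs_fps a) n * u ^ n) sums f u) (nhds 0)"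
      by eventually_elim (use s in auto)
  qed
  from fps_expansion_eqI[OF this] show ?thesis
    by (simp add: maclaurin_coeff_conv_fps_expansion)
qed

lemma maclaurin_coeff_mult:
  assumes "f holomorphic_on ball 0 r" "g holomorphic_on ball 0 r" "r > 0"
  shows "maclaurin_coeff (\<lambda>z. f z * g z) n = (\<Sum>i\<le>n. maclaurin_coeff f i * maclaurin_coeff g (n - i))"
proof -
  have "f has_fps_expansion fps_expansion f 0" "g has_fps_expansion fps_expansion g 0"
    using assms by (auto intro!: has_fps_expansion_fps_expansion[of "ball 0 r"])
  from fps_expansion_eqI[OF has_fps_expansion_mult[OF this]] show ?thesis
    by (simp add: maclaurin_coeff_conv_fps_expansion fps_mult_nth atLeast0AtMost)
qed

lemma maclaurin_coeff_deriv:
  "maclaurin_coeff (deriv f) n = of_nat (Suc n) * maclaurin_coeff f (Suc n)"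
proof -
  have "(deriv ^^ n) (deriv f) 0 = (deriv ^^ Suc n) f 0"
    by (simp add: funpow_swap1)
  then show ?thesis
    by (simp add: maclaurin_coeff_def field_simps del: funpow.simps of_nat_Suc)
qed

lemma summable_norm_maclaurin_coeff:
  assumes f: "f holomorphic_on ball 0 r" and "0 \<le> s" "s < r"
  shows "summable (\<lambda>n. cmod (maclaurin_coeff f n) * s ^ n)"
proof -
  \<comment> \<open>A point strictly between the two radii: convergence of the power series there
    gives absolute convergence on the smaller circle.\<close>
  define w :: complex where "w = of_real ((s + r) / 2)"
  have w: "cmod w = (s + r) / 2" using assms by (simp add: w_def del: of_real_add of_real_divide)
  then have w: "cmod w < r" "s < cmod w" using assms by auto
  have "summable (\<lambda>n. cmod (maclaurin_coeff f n * of_real s ^ n))"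
    using powser_insidea[OF sums_summable[OF maclaurin_coeff_sums[OF f w(1)]], of "of_real s"] w assms
    by simp
  then show ?thesis using assms by (simp add: norm_mult norm_power)
qed

lemma has_integral_cis_int:
  fixes m :: int
  shows "((\<lambda>\<theta>. cis (of_int m * \<theta>)) has_integral (if m = 0 then of_real (2 * pi) else 0)) {0..2 * pi}"
proof (cases "m = 0")
  case True
  then show ?thesis
    using has_integral_const_real[of "1::complex" 0 "2 * pi"] by (simp add: scaleR_conv_of_real)
next
  case False
  let ?F = "\<lambda>\<theta>. cis (of_int m * \<theta>) / (\<i> * of_int m)"
  have "((\<lambda>\<theta>. cis (of_int m * \<theta>)) has_integral (?F (2 * pi) - ?F 0)) {0..2 * pi}"
  proof (rule fundamental_theorem_of_calculus)
    fix x assume "x \<in> {0..2 * pi}"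
    show "(?F has_vector_derivative cis (of_int m * x)) (at x within {0..2 * pi})"
      unfolding cis_conv_exp using False
      by (auto intro!: derivative_eq_intros has_vector_derivative_real_field
          simp: field_simps scaleR_conv_of_real)
  qed auto
  moreover have "cis (of_int m * (2 * pi)) = 1"
    using cis_multiple_2pi[of "of_int m"] by (simp add: mult_ac)
  ultimately show ?thesis using False by simp
qed

text \<open>The argument is a point of the circle rather than its radius, so that the mean can
  itself be integrated over the disc against area measure.\<close>

definition circle_mean :: "(complex \<Rightarrow> real) \<Rightarrow> complex \<Rightarrow> ennreal" where
  "circle_mean h z = ennreal (1 / (2 * pi)) * (\<integral>\<^sup>+\<theta>\<in>{0..2 * pi}. ennreal (h (z * cis \<theta>)) \<partial>lborel)"

lemma circle_mean_square_trig_poly: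
  "circle_mean (\<lambda>w. (cmod (\<Sum>k<N. c k * w ^ k))\<^sup>2) z = (\<Sum>k<N. ennreal ((cmod (c k) * cmod z ^ k)\<^sup>2))"
proof -
  define d where "d k = c k * z ^ k" for k
  \<comment> \<open>The difference of exponents is formed in \<open>int\<close>, since it may be
    negative; only the diagonal survives integration.\<close>
  have eq: "complex_of_real ((cmod (\<Sum>k<N. c k * (z * cis \<theta>) ^ k))\<^sup>2) =
     (\<Sum>k<N. \<Sum>l<N. d k * cnj (d l) * cis (of_int (int k - int l) * \<theta>))" for \<theta>
  proof -
    have "(\<Sum>k<N. c k * (z * cis \<theta>) ^ k) = (\<Sum>k<N. d k * cis (real k * \<theta>))"
      by (simp add: d_def power_mult_distrib Complex.DeMoivre mult_ac)
    moreover have "cis (of_int (int k - int l) * \<theta>) = cis (real k * \<theta>) * cnj (cis (real l * \<theta>))" for k l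
      by (simp add: cis_mult cis_cnj ring_distribs)
    ultimately show ?thesis
      by (simp only: complex_norm_square) (simp add: sum_product mult_ac)
  qed
  have "((\<lambda>\<theta>. \<Sum>k<N. \<Sum>l<N. d k * cnj (d l) * cis (of_int (int k - int l) * \<theta>)) has_integral
      (\<Sum>k<N. \<Sum>l<N. d k * cnj (d l) * (if int k - int l = 0 then of_real (2 * pi) else 0))) {0..2*pi}"
    by (intro has_integral_sum has_integral_mult_right has_integral_cis_int) auto
  also have "(\<Sum>k<N. \<Sum>l<N. d k * cnj (d l) * (if int k - int l = 0 then of_real (2 * pi) else 0)) =
     of_real (2 * pi * (\<Sum>k<N. (cmod (d k))\<^sup>2))"
    by (simp add: sum_distrib_left mult.commute[of "2*pi"] if_distrib[of "\<lambda>x. _ * x"] complex_norm_square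
         cong: if_cong) (simp add: complex_norm_square[symmetric] algebra_simps)
  finally have "((\<lambda>\<theta>. complex_of_real ((cmod (\<Sum>k<N. c k * (z * cis \<theta>) ^ k))\<^sup>2)) has_integral
       of_real (2 * pi * (\<Sum>k<N. (cmod (d k))\<^sup>2))) {0..2*pi}"
    unfolding eq .
  from has_integral_Re[OF this] have "((\<lambda>\<theta>. (cmod (\<Sum>k<N. c k * (z * cis \<theta>) ^ k))\<^sup>2) has_integral
       (2 * pi * (\<Sum>k<N. (cmod (d k))\<^sup>2))) {0..2*pi}"
    by (simp only: Re_complex_of_real)
  then have *: "(\<integral>\<^sup>+\<theta>. ennreal (indicator {0..2*pi} \<theta> * (cmod (\<Sum>k<N. c k * (z * cis \<theta>) ^ k))\<^sup>2) \<partial>lborel) =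
      ennreal (2 * pi * (\<Sum>k<N. (cmod (d k))\<^sup>2))"
    by (intro nn_integral_has_integral_lebesgue) auto
  have "(\<integral>\<^sup>+\<theta>\<in>{0..2*pi}. ennreal ((cmod (\<Sum>k<N. c k * (z * cis \<theta>) ^ k))\<^sup>2) \<partial>lborel) =
      ennreal (2 * pi * (\<Sum>k<N. (cmod (d k))\<^sup>2))"
    unfolding *[symmetric] by (intro nn_integral_cong) (simp split: split_indicator)
  then show ?thesis
    unfolding circle_mean_def
    by (simp add: ennreal_mult[symmetric] sum_nonneg d_def norm_mult norm_power)
qed

lemma parseval:
  assumes f: "f holomorphic_on ball 0 R" and z: "cmod z < R"
  shows "circle_mean (\<lambda>w. (cmod (f w))\<^sup>2) z = (\<Sum>n. ennreal ((cmod (maclaurin_coeff f n) * cmod z ^ n)\<^sup>2))"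
proof -
  define s where "s N w = (\<Sum>k<N. maclaurin_coeff f k * w ^ k)" for N w
  \<comment> \<open>A majorant for all partial sums, uniform in the angle, as dominated convergence
    requires.\<close>
  define B where "B = (\<Sum>k. cmod (maclaurin_coeff f k) * cmod z ^ k)"
  have sB: "cmod (s N (z * cis \<theta>)) \<le> B" for N \<theta>
  proof -
    have "cmod (s N (z * cis \<theta>)) \<le> (\<Sum>k<N. cmod (maclaurin_coeff f k) * cmod z ^ k)"
      unfolding s_def by (rule sum_norm_le) (simp add: norm_mult norm_power)
    also have "\<dots> \<le> B"
      unfolding B_def by (rule sum_le_suminf[OF summable_norm_maclaurin_coeff[OF f]]) (use z in auto)
    finally show ?thesis .
  qed
  have sm: "(\<lambda>\<theta>. s N (z * cis \<theta>)) \<in> borel_measurable borel" for N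
    unfolding s_def by (intro borel_measurable_continuous_onI continuous_intros)
  have slim: "(\<lambda>N. s N (z * cis \<theta>)) \<longlonglongrightarrow> f (z * cis \<theta>)" for \<theta>
    using maclaurin_coeff_sums[OF f, of "z * cis \<theta>"] z unfolding sums_def s_def by (simp add: norm_mult)
  \<comment> \<open>Outside the disc f is arbitrary, so measurability along the circle is obtained
    from the converging polynomials.\<close>
  have fm: "(\<lambda>\<theta>. f (z * cis \<theta>)) \<in> borel_measurable borel"
    by (rule borel_measurable_LIMSEQ_metric[OF sm slim])
  have "(\<lambda>N. \<integral>\<^sup>+\<theta>\<in>{0..2*pi}. ennreal ((cmod (s N (z * cis \<theta>)))\<^sup>2) \<partial>lborel) \<longlonglongrightarrow>
    (\<integral>\<^sup>+\<theta>\<in>{0..2*pi}. ennreal ((cmod (f (z * cis \<theta>)))\<^sup>2) \<partial>lborel)"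
  proof (rule nn_integral_dominated_convergence[where w = "\<lambda>\<theta>. ennreal (B\<^sup>2) * indicator {0..2*pi} \<theta>"])
    show "(\<integral>\<^sup>+\<theta>. ennreal (B\<^sup>2) * indicator {0..2*pi} \<theta> \<partial>lborel) < \<infinity>"
      by (simp add: nn_integral_cmult_indicator ennreal_mult_less_top)
    show "AE \<theta> in lborel. ennreal ((cmod (s N (z * cis \<theta>)))\<^sup>2) * indicator {0..2*pi} \<theta>
        \<le> ennreal (B\<^sup>2) * indicator {0..2*pi} \<theta>" for N
      using sB by (auto intro!: AE_I2 mult_right_mono ennreal_leI power_mono)
    show "AE \<theta> in lborel. (\<lambda>N. ennreal ((cmod (s N (z * cis \<theta>)))\<^sup>2) * indicator {0..2*pi} \<theta>)
       \<longlonglongrightarrow> ennreal ((cmod (f (z * cis \<theta>)))\<^sup>2) * indicator {0..2*pi} \<theta>"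
      by (auto intro!: AE_I2 tendsto_intros slim simp: indicator_def)
  qed (use sm fm in measurable)
  then have "(\<lambda>N. circle_mean (\<lambda>w. (cmod (s N w))\<^sup>2) z) \<longlonglongrightarrow> circle_mean (\<lambda>w. (cmod (f w))\<^sup>2) z"
    unfolding circle_mean_def by (intro ennreal_tendsto_cmult) auto
  moreover have "(\<lambda>N. circle_mean (\<lambda>w. (cmod (s N w))\<^sup>2) z) \<longlonglongrightarrow>
      (\<Sum>n. ennreal ((cmod (maclaurin_coeff f n) * cmod z ^ n)\<^sup>2))"
    unfolding s_def circle_mean_square_trig_poly by (rule summable_LIMSEQ) simp
  ultimately show ?thesis using LIMSEQ_unique by blast
qed

section \<open>Hilbert's inequality\<close>

lemma suminf_ennreal_swap:
  fixes f :: "nat \<Rightarrow> nat \<Rightarrow> ennreal"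
  shows "(\<Sum>m. \<Sum>i. f i m) = (\<Sum>i. \<Sum>m. f i m)"
  using nn_integral_suminf[of f "count_space UNIV"]
  by (simp add: nn_integral_count_space_nat)

lemma suminf_ennreal_split_head:
  fixes f :: "nat \<Rightarrow> ennreal"
  shows "(\<Sum>n. f n) = f 0 + (\<Sum>n. f (Suc n))"
proof -
  have "(\<lambda>n. f (Suc n)) sums (\<Sum>n. f (Suc n))" by (intro summable_sums) simp
  from sums_Suc[OF this] show ?thesis by (simp add: sums_iff add.commute)
qed

lemma suminf_ennreal_shift_zero:
  fixes f :: "nat \<Rightarrow> ennreal"
  assumes "\<And>m. m < i \<Longrightarrow> f m = 0"
  shows "(\<Sum>m. f m) = (\<Sum>n. f (n + i))"
proof -
  have "(\<Sum>m<N + i. f m) = (\<Sum>n<N. f (n + i))" for N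
    by (induction N) (use assms in auto)
  moreover have "(\<lambda>N. \<Sum>m<N + i. f m) \<longlonglongrightarrow> (\<Sum>m. f m)"
    by (intro LIMSEQ_ignore_initial_segment summable_LIMSEQ) simp
  moreover have "(\<lambda>N. \<Sum>n<N. f (n + i)) \<longlonglongrightarrow> (\<Sum>n. f (n + i))"
    by (intro summable_LIMSEQ) simp
  ultimately show ?thesis using LIMSEQ_unique by fastforce
qed

text \<open>Tonelli with m = n + i. For w m = 1 / (m + 1) this turns a weighted Cauchy product into
  a form with the Hilbert kernel 1 / (n + i + 1), which is how that kernel enters both Hardy's
  inequality and the integral operator.\<close>

lemma suminf_ennreal_convolution:
  fixes x y w :: "nat \<Rightarrow> ennreal"
  shows "(\<Sum>m. (\<Sum>i\<le>m. x i * y (m - i)) * w m) = (\<Sum>i. x i * (\<Sum>n. y n * w (n + i)))"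
proof -
  have "(\<Sum>m. (\<Sum>i\<le>m. x i * y (m - i)) * w m) =
      (\<Sum>m. \<Sum>i. if i \<le> m then x i * y (m - i) * w m else 0)"
  proof (rule suminf_cong)
    fix m
    have "(\<Sum>i. if i \<le> m then x i * y (m - i) * w m else 0) =
        (\<Sum>i\<le>m. if i \<le> m then x i * y (m - i) * w m else 0)"
      by (rule suminf_finite) auto
    then show "(\<Sum>i\<le>m. x i * y (m - i)) * w m = (\<Sum>i. if i \<le> m then x i * y (m - i) * w m else 0)"
      by (simp add: sum_distrib_right)
  qed
  also have "\<dots> = (\<Sum>i. \<Sum>m. if i \<le> m then x i * y (m - i) * w m else 0)"
    by (rule suminf_ennreal_swap)
  also have "\<dots> = (\<Sum>i. \<Sum>n. x i * (y n * w (n + i)))"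
  proof (rule suminf_cong)
    fix i
    show "(\<Sum>m. if i \<le> m then x i * y (m - i) * w m else 0) = (\<Sum>n. x i * (y n * w (n + i)))"
      by (subst suminf_ennreal_shift_zero[of i]) (auto simp: mult_ac)
  qed
  finally show ?thesis by simp
qed

text \<open>The Hilbert kernel times the quotient p n / p i of the Schur weights p n = 1 / sqrt (n +
  1); Schur's test asks for bounded row sums of this matrix.\<close>

definition hilbert_weight :: "nat \<Rightarrow> nat \<Rightarrow> real" where
  "hilbert_weight i n = sqrt ((real i + 1) / (real n + 1)) / (real n + real i + 1)"

lemma hilbert_weight_nonneg: "hilbert_weight i n \<ge> 0"
  by (simp add: hilbert_weight_def)

text \<open>A closed form that telescopes in two regimes. While n \<le> i, the denominator n + i + 1
  is bounded below by i + 1 and the terms are compared with increments of 2 * sqrt n; beyond that it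
  is bounded below by n + 1 and the terms are compared with decrements of 2 / sqrt n. Both branches
  have the value 2 at N = i + 1, so the induction passes from one to the other.\<close>

lemma sum_hilbert_weight:
  "(\<Sum>n<N. hilbert_weight i n) \<le>
     (if N \<le> i + 1 then 2 * sqrt (real N) / sqrt (real i + 1) else 4 - 2 * sqrt (real i + 1) / sqrt (real N))"
proof (induction N)
  case 0
  show ?case by simp
next
  case (Suc n)
  define s t u where "s = sqrt (real i + 1)" and "t = sqrt (real n + 1)" and "u = sqrt (real n)"
  have pos: "s > 0" "t > 0" "u \<ge> 0" "u \<le> t" by (simp_all add: s_def t_def u_def)
  have sq: "s\<^sup>2 = real i + 1" "t\<^sup>2 = real n + 1" "u\<^sup>2 = real n" by (simp_all add: s_def t_def u_def)
  have K: "hilbert_weight i n = s / (t * (real n + s\<^sup>2))"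
    by (simp add: hilbert_weight_def real_sqrt_divide s_def t_def add_ac)
  have tu: "(t - u) * (t + u) = 1" using sq by (simp add: algebra_simps power2_eq_square)
  show ?case
  proof (cases "Suc n \<le> i + 1")
    case True
    have "s / (t * (real n + s\<^sup>2)) \<le> s / (t * s\<^sup>2)"
      using pos by (intro divide_left_mono mult_left_mono mult_pos_pos add_nonneg_pos) auto
    also have "\<dots> = (1 / t) / s" using pos by (simp add: power2_eq_square)
    also have "1 / t \<le> 2 * (t - u)"
    proof -
      have "1 = (t - u) * (t + u)" using tu by simp
      also have "\<dots> \<le> (t - u) * (2 * t)" using pos by (intro mult_left_mono) auto
      finally show ?thesis using pos by (simp add: field_simps)
    qed
    finally have "hilbert_weight i n \<le> 2 * t / s - 2 * u / s"
      using pos K by (simp add: divide_right_mono field_simps)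
    then show ?thesis using Suc True by (simp add: s_def t_def u_def add_ac)
  next
    case False
    then have n: "real n \<ge> real i + 1" by linarith
    then have u: "u > 0" using u_def by simp
    have "s / (t * (real n + s\<^sup>2)) \<le> s / (t * t\<^sup>2)"
      using pos sq n by (intro divide_left_mono mult_left_mono) auto
    also have "\<dots> \<le> s * (2 / u - 2 / t)"
    proof -
      have "2 / u - 2 / t = 2 * ((t - u) * (t + u)) / (t * (u * (t + u)))"
      proof -
        have "t * u \<noteq> 0" "t + u \<noteq> 0" using pos u by auto
        have "2 / u - 2 / t = 2 * (t - u) / (t * u)" using pos u by (simp add: field_simps)
        also have "\<dots> = 2 * (t - u) * (t + u) / (t * u * (t + u))" using \<open>t + u \<noteq> 0\<close> by simp
        finally show ?thesis by (simp only: mult.assoc)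
      qed
      also have "\<dots> = 2 / (t * (u * (t + u)))" using tu by simp
      also have "\<dots> \<ge> 2 / (t * (2 * t\<^sup>2))"
      proof -
        have "u * (t + u) \<le> t * (2 * t)" using pos by (intro mult_mono) auto
        then show ?thesis using pos u
          by (intro divide_left_mono mult_left_mono) (auto simp: power2_eq_square)
      qed
      finally have "1 / (t * t\<^sup>2) \<le> 2 / u - 2 / t" by simp
      from mult_left_mono[OF this, of s] show ?thesis using pos by simp
    qed
    finally have "hilbert_weight i n \<le> 2 * s / u - 2 * s / t"
      using K by (simp add: algebra_simps)
    moreover have "(\<Sum>n<n. hilbert_weight i n) \<le> 4 - 2 * s / u"
    proof (cases "n \<le> i + 1")
      case True
      with n have "real n = real i + 1" by linarith
      then have "u = s" by (simp add: u_def s_def)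
      then show ?thesis using Suc True pos \<open>real n = real i + 1\<close> by (simp add: s_def)
    next
      case False
      then show ?thesis using Suc by (simp add: s_def u_def)
    qed
    ultimately show ?thesis using False by (simp add: s_def t_def add_ac)
  qed
qed

lemma suminf_hilbert_weight_le: "(\<Sum>n. ennreal (hilbert_weight i n)) \<le> 4"
proof (rule suminf_le_const)
  fix N
  have "(\<Sum>n<N. hilbert_weight i n) \<le> 4"
  proof (cases "N \<le> i + 1")
    case True
    then have "sqrt (real N) / sqrt (real i + 1) \<le> 1" by (simp add: field_simps)
    then have "sqrt (real N) \<le> sqrt (real i + 1)" by simp
    then have "2 * sqrt (real N) / sqrt (real i + 1) \<le> 2" by (simp add: divide_le_eq)
    then show ?thesis using sum_hilbert_weight[of i N] True by simp
  next
    case False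
    then show ?thesis using sum_hilbert_weight[of i N] by (smt (verit) divide_nonneg_nonneg real_sqrt_ge_0_iff of_nat_0_le_iff)
  qed
  then have "ennreal (\<Sum>n<N. hilbert_weight i n) \<le> ennreal 4" by (rule ennreal_leI)
  then show "(\<Sum>n<N. ennreal (hilbert_weight i n)) \<le> 4" by (simp add: hilbert_weight_nonneg)
qed simp

text \<open>Schur's test with the weights \<open>1 / sqrt (n + 1)\<close>.\<close>

lemma hilbert_inequality:
  fixes x y :: "nat \<Rightarrow> real"
  assumes x: "\<And>i. x i \<ge> 0" and y: "\<And>i. y i \<ge> 0"
  shows "(\<Sum>i. ennreal (x i) * (\<Sum>n. ennreal (y n) * ennreal (1 / (real (n + i) + 1)))) \<le>
     2 * ((\<Sum>i. ennreal ((x i)\<^sup>2)) + (\<Sum>n. ennreal ((y n)\<^sup>2)))"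
proof -
  let ?K = "\<lambda>i n. ennreal (hilbert_weight i n)"
  have half: "ennreal (1/2) * 4 = 2"
    using ennreal_mult[of "1/2" 4] by simp
  have bound: "ennreal (x i) * (ennreal (y n) * ennreal (1 / (real (n + i) + 1))) \<le>
     ennreal (1/2) * (ennreal ((x i)\<^sup>2) * ?K i n) + ennreal (1/2) * (ennreal ((y n)\<^sup>2) * ?K n i)" for i n
  proof -
    define a where "a = sqrt ((real i + 1) / (real n + 1))"
    have a: "a > 0" by (simp add: a_def)
    have a': "sqrt ((real n + 1) / (real i + 1)) = 1 / a"
      by (simp add: a_def real_sqrt_divide)
    \<comment> \<open>Weighted arithmetic-geometric mean inequality: the ratio a attaches
      \<open>hilbert_weight i n\<close> to the square of x i and, with exchanged indices,
      \<open>hilbert_weight n i\<close> to the square of y n.\<close>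
    have "0 \<le> (x i * a - y n)\<^sup>2" by simp
    then have "2 * (x i * y n) * a \<le> ((x i)\<^sup>2 * a + (y n)\<^sup>2 * (1 / a)) * a"
      using a by (simp add: power2_eq_square algebra_simps)
    then have "2 * (x i * y n) \<le> (x i)\<^sup>2 * a + (y n)\<^sup>2 * (1 / a)"
      using a mult_le_cancel_right_pos by blast
    then have "2 * (x i * y n) / (real n + real i + 1) \<le> ((x i)\<^sup>2 * a + (y n)\<^sup>2 * (1 / a)) / (real n + real i + 1)"
      by (rule divide_right_mono) simp
    also have "\<dots> = (x i)\<^sup>2 * hilbert_weight i n + (y n)\<^sup>2 * hilbert_weight n i"
      unfolding hilbert_weight_def a' unfolding a_def by (simp add: add_divide_distrib add_ac)
    finally have "x i * (y n * (1 / (real (n + i) + 1))) \<le>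
       1/2 * ((x i)\<^sup>2 * hilbert_weight i n) + 1/2 * ((y n)\<^sup>2 * hilbert_weight n i)" by simp
    then have "ennreal (x i * (y n * (1 / (real (n + i) + 1)))) \<le>
       ennreal (1/2 * ((x i)\<^sup>2 * hilbert_weight i n) + 1/2 * ((y n)\<^sup>2 * hilbert_weight n i))"
      by (rule ennreal_leI)
    then show ?thesis
      by (simp only: ennreal_mult ennreal_plus hilbert_weight_nonneg x y mult_nonneg_nonneg
          zero_le_power2 zero_le_divide_1_iff of_nat_0_le_iff add_nonneg_nonneg zero_le_one zero_le_numeral)
  qed
  have "(\<Sum>i. ennreal (x i) * (\<Sum>n. ennreal (y n) * ennreal (1 / (real (n + i) + 1)))) =
    (\<Sum>i. \<Sum>n. ennreal (x i) * (ennreal (y n) * ennreal (1 / (real (n + i) + 1))))" by simp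
  also have "\<dots> \<le> (\<Sum>i. \<Sum>n. ennreal (1/2) * (ennreal ((x i)\<^sup>2) * ?K i n) + ennreal (1/2) * (ennreal ((y n)\<^sup>2) * ?K n i))"
    by (intro suminf_le bound) auto
  also have "\<dots> = (\<Sum>i. \<Sum>n. ennreal (1/2) * (ennreal ((x i)\<^sup>2) * ?K i n)) +
      (\<Sum>i. \<Sum>n. ennreal (1/2) * (ennreal ((y n)\<^sup>2) * ?K n i))"
    by (simp add: suminf_add[symmetric] del: ennreal_suminf_cmult)
  also have "(\<Sum>i. \<Sum>n. ennreal (1/2) * (ennreal ((y n)\<^sup>2) * ?K n i)) = (\<Sum>n. \<Sum>i. ennreal (1/2) * (ennreal ((y n)\<^sup>2) * ?K n i))"
    by (rule suminf_ennreal_swap)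
  finally have *: "(\<Sum>i. ennreal (x i) * (\<Sum>n. ennreal (y n) * ennreal (1 / (real (n + i) + 1)))) \<le>
     (\<Sum>i. \<Sum>n. ennreal (1/2) * (ennreal ((x i)\<^sup>2) * ?K i n)) + (\<Sum>n. \<Sum>i. ennreal (1/2) * (ennreal ((y n)\<^sup>2) * ?K n i))" .
  have z: "(\<Sum>i. \<Sum>n. ennreal (1/2) * (ennreal ((z i)\<^sup>2) * ?K i n)) \<le> 2 * (\<Sum>i. ennreal ((z i)\<^sup>2))" for z :: "nat \<Rightarrow> real"
  proof -
    have "(\<Sum>i. \<Sum>n. ennreal (1/2) * (ennreal ((z i)\<^sup>2) * ?K i n)) =
       ennreal (1/2) * (\<Sum>i. ennreal ((z i)\<^sup>2) * (\<Sum>n. ?K i n))" by simp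
    also have "\<dots> \<le> ennreal (1/2) * (\<Sum>i. ennreal ((z i)\<^sup>2) * 4)"
      by (intro mult_left_mono suminf_le suminf_hilbert_weight_le) auto
    also have "\<dots> = (ennreal (1/2) * 4) * (\<Sum>i. ennreal ((z i)\<^sup>2))"
      by (subst ennreal_suminf_multc) (simp only: mult_ac)
    finally show ?thesis unfolding half .
  qed
  show ?thesis
    using order_trans[OF * add_mono[OF z z]] by (simp add: distrib_left)
qed

section \<open>Hardy's inequality\<close>

text \<open>
  A polynomial without zeros on the unit circle is a product \<open>u * v\<close> with \<open>\<bar>u\<bar> = \<bar>v\<bar>\<close> on the
  circle: distribute a square root of every factor \<open>z - a\<close> with \<open>\<bar>a\<bar> > 1\<close> over both, and write
  \<open>z - a\<close> with \<open>\<bar>a\<bar> < 1\<close> as a Blaschke factor times \<open>1 - cnj a * z\<close>.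
\<close>

lemma poly_factorization_equal_modulus:
  fixes p :: "complex poly"
  assumes "p \<noteq> 0" "\<And>z. cmod z = 1 \<Longrightarrow> poly p z \<noteq> 0"
  shows "\<exists>R u v. R > 1 \<and> u holomorphic_on ball 0 R \<and> v holomorphic_on ball 0 R \<and>
      (\<forall>z\<in>ball 0 R. poly p z = u z * v z) \<and>
      (\<forall>z. cmod z = 1 \<longrightarrow> (cmod (u z))\<^sup>2 = cmod (poly p z) \<and> (cmod (v z))\<^sup>2 = cmod (poly p z))"
  using assms
proof (induction "degree p" arbitrary: p rule: less_induct)
  case less
  show ?case
  proof (cases "degree p = 0")
    case True
    then obtain c where c: "p = [:c:]" by (rule degree_eq_zeroE)
    have sq: "csqrt c * csqrt c = c" by (metis power2_csqrt power2_eq_square)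
    moreover have "(cmod (csqrt c))\<^sup>2 = cmod c" by (metis norm_power power2_csqrt)
    ultimately show ?thesis unfolding c
      \<comment> \<open>A constant is entire, so any radius above 1 would do.\<close>
      by (intro exI[of _ 2] exI[of _ "\<lambda>_. csqrt c"]) (auto intro!: holomorphic_intros)
  next
    case False
    then have "\<exists>i\<in>{1..degree p}. coeff p i \<noteq> 0"
      by (intro bexI[of _ "degree p"]) auto
    then obtain a where "poly p a = 0"
      using fundamental_theorem_of_algebra[of "coeff p" "degree p"] by (auto simp: poly_altdef)
    then obtain q where pq: "p = [:-a, 1:] * q" by (auto simp: poly_eq_0_iff_dvd elim: dvdE)
    have q: "q \<noteq> 0" "degree q < degree p" "\<And>z. cmod z = 1 \<Longrightarrow> poly q z \<noteq> 0"
    proof -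
      show "q \<noteq> 0" using less.prems(1) pq by auto
      then show "degree q < degree p" unfolding pq by (subst degree_mult_eq) auto
      show "poly q z \<noteq> 0" if "cmod z = 1" for z
        using less.prems(2)[OF that] pq by auto
    qed
    have pz: "poly p z = (z - a) * poly q z" for z by (simp add: pq algebra_simps)
    have a1: "cmod a \<noteq> 1" using less.prems(2)[of a] pz[of a] by auto
    from less.hyps[OF q(2,1,3)] obtain R u v where uv: "R > 1" "u holomorphic_on ball 0 R" "v holomorphic_on ball 0 R"
      "\<And>z. z \<in> ball 0 R \<Longrightarrow> poly q z = u z * v z"
      "\<And>z. cmod z = 1 \<Longrightarrow> (cmod (u z))\<^sup>2 = cmod (poly q z)"
      "\<And>z. cmod z = 1 \<Longrightarrow> (cmod (v z))\<^sup>2 = cmod (poly q z)"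
      by blast
    have nonpos: "1 - w \<notin> \<real>\<^sub>\<le>\<^sub>0" if "cmod w < 1" for w
      using complex_Re_le_cmod[of w] that by (auto simp: complex_nonpos_Reals_iff)
    have csq: "csqrt w * csqrt w = w" "(cmod (csqrt w))\<^sup>2 = cmod w" for w
      by (metis power2_csqrt power2_eq_square) (metis norm_power power2_csqrt)
    show ?thesis
    proof (cases "cmod a < 1")
      case True
      \<comment> \<open>Below 1 / \<bar>a\<bar> the product cnj a * z stays in the unit disc: the
        Blaschke denominator has no zero and 1 - cnj a * z avoids the branch cut of
        \<open>csqrt\<close>.\<close>
      define R' where "R' = (if a = 0 then R else min R (1 / cmod a))"
      define w where "w z = csqrt (1 - cnj a * z)" for z
      define b where "b z = (z - a) / (1 - cnj a * z)" for z
      have R': "R' > 1" "R' \<le> R" using True uv(1) by (auto simp: R'_def)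
      have small: "cmod (cnj a * z) < 1" if "z \<in> ball 0 R'" for z
        using that by (auto simp: R'_def norm_mult field_simps split: if_splits)
      have nz: "1 - cnj a * z \<noteq> 0" if "z \<in> ball 0 R'" for z
        using small[OF that] by auto
      have w: "w holomorphic_on ball 0 R'"
        unfolding w_def using nonpos small by (intro holomorphic_intros) auto
      have b: "b holomorphic_on ball 0 R'"
        unfolding b_def using nz by (intro holomorphic_intros) auto
      have b1: "cmod (b z) = 1" if "cmod z = 1" for z
      proof -
        \<comment> \<open>Uses z * cnj z = 1 on the unit circle; this is why Blaschke factors are
          unimodular there.\<close>
        have "1 - cnj a * z = z * cnj (z - a)"
          using that by (simp add: algebra_simps complex_norm_square[symmetric] mult.commute[of "cnj z"])
        then have "cmod (1 - cnj a * z) = cmod (z - a)"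
          using that by (simp only: norm_mult complex_mod_cnj)
        moreover have "z \<noteq> a" using that True by auto
        ultimately show ?thesis by (simp add: b_def norm_divide)
      qed
      have w1: "(cmod (w z))\<^sup>2 = cmod (z - a)" if "cmod z = 1" for z
        using b1[OF that] by (auto simp: w_def csq b_def norm_divide divide_eq_eq split: if_splits)
      show ?thesis
      proof (rule exI[of _ R'], rule exI[of _ "\<lambda>z. u z * w z"], rule exI[of _ "\<lambda>z. v z * (w z * b z)"], intro conjI ballI allI impI)
        show "R' > 1" by fact
        show "(\<lambda>z. u z * w z) holomorphic_on ball 0 R'" "(\<lambda>z. v z * (w z * b z)) holomorphic_on ball 0 R'"
          using uv(2,3) w b R' by (auto intro!: holomorphic_intros intro: holomorphic_on_subset)
        fix z :: complex assume z: "z \<in> ball 0 R'"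
        have "w z * (w z * b z) = (w z * w z) * b z" by (simp only: mult.assoc)
        also have "w z * w z = 1 - cnj a * z" unfolding w_def by (rule csq)
        finally have "w z * (w z * b z) = z - a" using nz[OF z] by (simp add: b_def)
        moreover have "poly q z = u z * v z" using z R' uv(4) by auto
        ultimately show "poly p z = u z * w z * (v z * (w z * b z))"
          by (simp add: pz mult_ac)
      next
        fix z :: complex assume z: "cmod z = 1"
        show "(cmod (u z * w z))\<^sup>2 = cmod (poly p z)" "(cmod (v z * (w z * b z)))\<^sup>2 = cmod (poly p z)"
          unfolding norm_mult power_mult_distrib pz uv(5,6)[OF z] w1[OF z] b1[OF z] by simp_all
      qed
    next
      case False
      with a1 have a: "cmod a > 1" by auto
      then have a0: "a \<noteq> 0" by auto
      define R' where "R' = min R (cmod a)"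
      \<comment> \<open>A direct principal root of z - a could meet the branch cut. With the
        constant - a split off, the remaining argument 1 - z / a lies in the disc of radius 1 about
        1.\<close>
      define w where "w z = csqrt (- a) * csqrt (1 - z / a)" for z
      have R': "R' > 1" "R' \<le> R" using a uv(1) by (auto simp: R'_def)
      have small: "cmod (z / a) < 1" if "z \<in> ball 0 R'" for z
        using that a a0 by (auto simp: R'_def norm_divide divide_less_eq)
      have w: "w holomorphic_on ball 0 R'"
        unfolding w_def using nonpos small a0 by (intro holomorphic_intros) auto
      have ww: "w z * w z = z - a" for z
      proof -
        have "w z * w z = (csqrt (- a) * csqrt (- a)) * (csqrt (1 - z / a) * csqrt (1 - z / a))"
          by (simp add: w_def mult_ac)
        also have "\<dots> = - a * (1 - z / a)" unfolding csq ..
        also have "\<dots> = z - a" using a0 by (simp add: right_diff_distrib)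
        finally show ?thesis .
      qed
      have w1: "(cmod (w z))\<^sup>2 = cmod (z - a)" for z
        by (metis ww norm_mult power2_eq_square)
      show ?thesis
      proof (rule exI[of _ R'], rule exI[of _ "\<lambda>z. u z * w z"], rule exI[of _ "\<lambda>z. v z * w z"], intro conjI ballI allI impI)
        show "R' > 1" by fact
        show "(\<lambda>z. u z * w z) holomorphic_on ball 0 R'" "(\<lambda>z. v z * w z) holomorphic_on ball 0 R'"
          using uv(2,3) w R' by (auto intro!: holomorphic_intros intro: holomorphic_on_subset)
        fix z :: complex assume z: "z \<in> ball 0 R'"
        have "poly q z = u z * v z" using z R' uv(4) by auto
        then show "poly p z = u z * w z * (v z * w z)"
          unfolding pz ww[symmetric] by (simp add: mult_ac)
      next
        fix z :: complex assume z: "cmod z = 1"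
        show "(cmod (u z * w z))\<^sup>2 = cmod (poly p z)" "(cmod (v z * w z))\<^sup>2 = cmod (poly p z)"
          unfolding norm_mult power_mult_distrib pz uv(5,6)[OF z] w1 by simp_all
      qed
    qed
  qed
qed

text \<open>Serves two purposes: x and y are the coefficient moduli of the factors u and v in
  Hardy's inequality, and those of f and g' in the bound for the integral operator.\<close>

lemma suminf_convolution_weighted_le:
  assumes "\<And>n. ennreal (cmod (h n)) \<le> (\<Sum>i\<le>n. ennreal (x i) * ennreal (y (n - i)))"
  shows "(\<Sum>n. ennreal (cmod (h n) / (real n + 1))) \<le>
    (\<Sum>i. ennreal (x i) * (\<Sum>n. ennreal (y n) * ennreal (1 / (real (n + i) + 1))))"
proof -
  have "(\<Sum>n. ennreal (cmod (h n) / (real n + 1))) \<le>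
      (\<Sum>n. (\<Sum>i\<le>n. ennreal (x i) * ennreal (y (n - i))) * ennreal (1 / (real n + 1)))"
  proof (rule suminf_le)
    fix n
    have "ennreal (cmod (h n) / (real n + 1)) = ennreal (cmod (h n)) * ennreal (1 / (real n + 1))"
      by (subst ennreal_mult[symmetric]) auto
    then show "ennreal (cmod (h n) / (real n + 1)) \<le>
        (\<Sum>i\<le>n. ennreal (x i) * ennreal (y (n - i))) * ennreal (1 / (real n + 1))"
      using assms by (simp add: mult_right_mono)
  qed auto
  then show ?thesis
    unfolding suminf_ennreal_convolution[of "\<lambda>i. ennreal (x i)" "\<lambda>i. ennreal (y i)"] .
qed

lemma maclaurin_coeff_mult_norm_le:
  assumes "f holomorphic_on ball 0 r" "g holomorphic_on ball 0 r" "r > 0"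
  shows "ennreal (cmod (maclaurin_coeff (\<lambda>z. f z * g z) n)) \<le>
     (\<Sum>i\<le>n. ennreal (cmod (maclaurin_coeff f i)) * ennreal (cmod (maclaurin_coeff g (n - i))))"
proof -
  have "cmod (maclaurin_coeff (\<lambda>z. f z * g z) n) \<le>
     (\<Sum>i\<le>n. cmod (maclaurin_coeff f i) * cmod (maclaurin_coeff g (n - i)))"
    unfolding maclaurin_coeff_mult[OF assms] by (rule sum_norm_le) (simp add: norm_mult)
  from ennreal_leI[OF this] show ?thesis by (simp flip: ennreal_mult)
qed

lemma hardy_inequality_poly:
  fixes p :: "complex poly"
  assumes "\<And>z. cmod z = 1 \<Longrightarrow> poly p z \<noteq> 0"
  shows "(\<Sum>n. ennreal (cmod (coeff p n) / (real n + 1))) \<le> 4 * circle_mean (\<lambda>w. cmod (poly p w)) 1"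
proof -
  have "p \<noteq> 0" using assms[of 1] by auto
  from poly_factorization_equal_modulus[OF this assms]
  obtain R u v where uv: "R > 1" "u holomorphic_on ball 0 R" "v holomorphic_on ball 0 R"
      "\<And>z. z \<in> ball 0 R \<Longrightarrow> poly p z = u z * v z"
      "\<And>z. cmod z = 1 \<Longrightarrow> (cmod (u z))\<^sup>2 = cmod (poly p z)"
      "\<And>z. cmod z = 1 \<Longrightarrow> (cmod (v z))\<^sup>2 = cmod (poly p z)" by blast
  have c: "maclaurin_coeff (\<lambda>z. u z * v z) n = coeff p n" for n
  proof (rule maclaurin_coeff_eqI)
    show "R > 0" using uv(1) by simp
    fix z :: complex assume "cmod z < R"
    then have "u z * v z = poly p z" using uv(4) by simp
    moreover have "(\<lambda>n. coeff p n * z ^ n) sums (\<Sum>n\<le>degree p. coeff p n * z ^ n)"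
      by (rule sums_finite) (auto simp: coeff_eq_0)
    ultimately show "(\<lambda>n. coeff p n * z ^ n) sums (u z * v z)"
      by (simp add: poly_altdef)
  qed
  have mean: "circle_mean (\<lambda>w. (cmod (g w))\<^sup>2) 1 = circle_mean (\<lambda>w. cmod (poly p w)) 1"
    if "\<And>z. cmod z = 1 \<Longrightarrow> (cmod (g z))\<^sup>2 = cmod (poly p z)" for g
    unfolding circle_mean_def by (simp add: that)
  let ?a = "\<lambda>f n. cmod (maclaurin_coeff f n)"
  have "(\<Sum>n. ennreal (cmod (coeff p n) / (real n + 1))) \<le>
      (\<Sum>i. ennreal (?a u i) * (\<Sum>n. ennreal (?a v n) * ennreal (1 / (real (n + i) + 1))))"
    unfolding c[symmetric] by (intro suminf_convolution_weighted_le maclaurin_coeff_mult_norm_le[OF uv(2,3)]) (use uv(1) in simp)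
  also have "\<dots> \<le> 2 * ((\<Sum>i. ennreal ((?a u i)\<^sup>2)) + (\<Sum>n. ennreal ((?a v n)\<^sup>2)))"
    by (rule hilbert_inequality) auto
  also have "(\<Sum>i. ennreal ((?a u i)\<^sup>2)) = circle_mean (\<lambda>w. cmod (poly p w)) 1"
    by (subst mean[of u, OF uv(5), symmetric], assumption, subst parseval[OF uv(2)]) (use uv(1) in simp_all)
  also have "(\<Sum>i. ennreal ((?a v i)\<^sup>2)) = circle_mean (\<lambda>w. cmod (poly p w)) 1"
    by (subst mean[of v, OF uv(6), symmetric], assumption, subst parseval[OF uv(3)]) (use uv(1) in simp_all)
  also have "2 * (circle_mean (\<lambda>w. cmod (poly p w)) 1 + circle_mean (\<lambda>w. cmod (poly p w)) 1) =
      (2 + 2) * circle_mean (\<lambda>w. cmod (poly p w)) 1"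
    by (simp only: distrib_left distrib_right)
  finally show ?thesis by simp
qed

section \<open>Hardy's inequality: from polynomials on the unit circle to analytic functions on the
  disc\<close>

lemma hardy_inequality_trig_poly:
  fixes c :: "nat \<Rightarrow> complex"
  assumes "\<And>w. cmod w = cmod a \<Longrightarrow> (\<Sum>k\<le>N. c k * w ^ k) \<noteq> 0"
  shows "(\<Sum>k\<le>N. ennreal (cmod (c k) * cmod a ^ k / (real k + 1))) \<le>
     4 * circle_mean (\<lambda>w. cmod (\<Sum>k\<le>N. c k * w ^ k)) a"
proof -
  \<comment> \<open>The substitution w = a * z absorbs radius and phase of a into the coefficients
    and moves the circle through a to the unit circle.\<close>
  define q where "q = (\<Sum>k\<le>N. monom (c k * a ^ k) k)"
  have q: "poly q w = (\<Sum>k\<le>N. c k * (a * w) ^ k)" for w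
    by (simp add: q_def poly_sum poly_monom power_mult_distrib mult_ac)
  have cq: "coeff q k = (if k \<le> N then c k * a ^ k else 0)" for k
    by (simp add: q_def coeff_sum)
  have "(\<Sum>k. ennreal (cmod (coeff q k) / (real k + 1))) = (\<Sum>k\<le>N. ennreal (cmod (coeff q k) / (real k + 1)))"
    by (rule suminf_finite) (auto simp: cq)
  also have "\<dots> = (\<Sum>k\<le>N. ennreal (cmod (c k) * cmod a ^ k / (real k + 1)))"
    by (simp add: cq norm_mult norm_power)
  finally have "(\<Sum>k\<le>N. ennreal (cmod (c k) * cmod a ^ k / (real k + 1))) \<le> 4 * circle_mean (\<lambda>w. cmod (poly q w)) 1"
    using hardy_inequality_poly[of q] assms by (simp add: q norm_mult)
  also have "circle_mean (\<lambda>w. cmod (poly q w)) 1 = circle_mean (\<lambda>w. cmod (\<Sum>k\<le>N. c k * w ^ k)) a"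
    by (simp add: circle_mean_def q)
  finally show ?thesis .
qed

text \<open>A nonzero polynomial has finitely many roots, whose moduli cannot exhaust an
  interval.\<close>

lemma ex_radius_avoiding_roots:
  fixes c :: "nat \<Rightarrow> complex"
  assumes "r < s" "c n \<noteq> 0" "n \<le> N"
  shows "\<exists>t. r < t \<and> t < s \<and> (\<forall>w. cmod w = t \<longrightarrow> (\<Sum>k\<le>N. c k * w ^ k) \<noteq> 0)"
proof -
  have "finite {w. (\<Sum>k\<le>N. c k * w ^ k) = 0}"
    using assms polyfun_finite_roots[of c N] by auto
  then have "infinite ({r<..<s} - cmod ` {w. (\<Sum>k\<le>N. c k * w ^ k) = 0})"
    using assms by (intro Diff_infinite_finite) auto
  then obtain t where "t \<in> {r<..<s} - cmod ` {w. (\<Sum>k\<le>N. c k * w ^ k) = 0}"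
    by (metis finite.emptyI equals0I)
  then show ?thesis by (intro exI[of _ t]) auto
qed

text \<open>The point a n moves with the degree because the zero-free circle depends on the Taylor
  polynomial. The coefficient series at radius s < 1 is the common majorant, for Tannery's theorem
  at each angle and for dominated convergence in the angle.\<close>

lemma circle_mean_tendsto:
  assumes f: "f holomorphic_on ball 0 1" and a: "\<And>n. cmod (a n) \<le> s" "a \<longlonglongrightarrow> z" and s: "s < 1"
  shows "(\<lambda>n. circle_mean (\<lambda>w. cmod (\<Sum>k\<le>n. maclaurin_coeff f k * w ^ k)) (a n)) \<longlonglongrightarrow> circle_mean (\<lambda>w. cmod (f w)) z"
proof -
  let ?c = "maclaurin_coeff f"
  have s0: "0 \<le> s" using a(1)[of 0] norm_ge_zero order_trans by blast
  have z: "cmod z \<le> s" using a by (intro LIMSEQ_le_const2[OF tendsto_norm]) auto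
  have summ: "summable (\<lambda>k. cmod (?c k) * s ^ k)"
    using summable_norm_maclaurin_coeff[OF f s0 s] .
  define p where "p n w = (\<Sum>k\<le>n. ?c k * w ^ k)" for n w
  define B where "B = (\<Sum>k. cmod (?c k) * s ^ k)"
  have tm: "cmod (?c k * (a n * cis \<theta>) ^ k) \<le> cmod (?c k) * s ^ k" for k n \<theta>
    using a(1) by (auto simp: norm_mult norm_power intro!: mult_left_mono power_mono)
  have pB: "cmod (p n (a n * cis \<theta>)) \<le> B" for n \<theta>
  proof -
    have "cmod (p n (a n * cis \<theta>)) \<le> (\<Sum>k\<le>n. cmod (?c k) * s ^ k)"
      unfolding p_def by (rule sum_norm_le) (rule tm)
    also have "\<dots> \<le> B"
      unfolding B_def by (rule sum_le_suminf[OF summ]) (use s0 in auto)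
    finally show ?thesis .
  qed
  have pm: "(\<lambda>\<theta>. p n (a n * cis \<theta>)) \<in> borel_measurable borel" for n
    unfolding p_def by (intro borel_measurable_continuous_onI continuous_intros)
  have plim: "(\<lambda>n. p n (a n * cis \<theta>)) \<longlonglongrightarrow> f (z * cis \<theta>)" for \<theta>
  proof -
    let ?u = "\<lambda>k n. if k \<le> n then ?c k * (a n * cis \<theta>) ^ k else 0"
    have "(\<lambda>n. \<Sum>k. ?u k n) \<longlonglongrightarrow> (\<Sum>k. ?c k * (z * cis \<theta>) ^ k)"
    proof (rule conjunct2[OF conjunct2[OF tannerys_theorem[OF _ _ summ]]])
      fix k
      have "(\<lambda>n. ?c k * (a n * cis \<theta>) ^ k) \<longlonglongrightarrow> ?c k * (z * cis \<theta>) ^ k"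
        by (intro tendsto_intros a)
      moreover have "eventually (\<lambda>n. ?c k * (a n * cis \<theta>) ^ k = ?u k n) sequentially"
        using eventually_ge_at_top[of k] by eventually_elim auto
      ultimately show "(\<lambda>n. ?u k n) \<longlonglongrightarrow> ?c k * (z * cis \<theta>) ^ k"
        by (rule Lim_transform_eventually)
    next
      show "eventually (\<lambda>(k,n). norm (?u k n) \<le> cmod (?c k) * s ^ k) (at_top \<times>\<^sub>F sequentially)"
        using tm s0 by (intro always_eventually) (auto simp: case_prod_beta)
    qed auto
    moreover have "(\<Sum>k. ?u k n) = p n (a n * cis \<theta>)" for n
      unfolding p_def by (subst suminf_finite[of "{..n}"]) auto
    moreover have "(\<Sum>k. ?c k * (z * cis \<theta>) ^ k) = f (z * cis \<theta>)"
      using maclaurin_coeff_sums[OF f, of "z * cis \<theta>"] z s by (simp add: sums_iff norm_mult)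
    ultimately show ?thesis by simp
  qed
  have fm: "(\<lambda>\<theta>. f (z * cis \<theta>)) \<in> borel_measurable borel"
    by (rule borel_measurable_LIMSEQ_metric[OF pm plim])
  have "(\<lambda>n. \<integral>\<^sup>+\<theta>\<in>{0..2*pi}. ennreal (cmod (p n (a n * cis \<theta>))) \<partial>lborel) \<longlonglongrightarrow>
    (\<integral>\<^sup>+\<theta>\<in>{0..2*pi}. ennreal (cmod (f (z * cis \<theta>))) \<partial>lborel)"
  proof (rule nn_integral_dominated_convergence[where w = "\<lambda>\<theta>. ennreal B * indicator {0..2*pi} \<theta>"])
    show "(\<integral>\<^sup>+\<theta>. ennreal B * indicator {0..2*pi} \<theta> \<partial>lborel) < \<infinity>"
      by (simp add: nn_integral_cmult_indicator ennreal_mult_less_top)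
    show "AE \<theta> in lborel. ennreal (cmod (p n (a n * cis \<theta>))) * indicator {0..2*pi} \<theta>
        \<le> ennreal B * indicator {0..2*pi} \<theta>" for n
      using pB by (auto intro!: mult_right_mono ennreal_leI)
    show "AE \<theta> in lborel. (\<lambda>n. ennreal (cmod (p n (a n * cis \<theta>))) * indicator {0..2*pi} \<theta>)
       \<longlonglongrightarrow> ennreal (cmod (f (z * cis \<theta>))) * indicator {0..2*pi} \<theta>"
      by (auto intro!: tendsto_intros plim simp: indicator_def)
  qed (use pm fm in measurable)
  then show ?thesis
    unfolding circle_mean_def p_def by (intro ennreal_tendsto_cmult) auto
qed

lemma hardy_inequality:
  assumes f: "f holomorphic_on ball 0 1" and z: "cmod z < 1"
  shows "(\<Sum>n. ennreal (cmod (maclaurin_coeff f n) * cmod z ^ n / (real n + 1))) \<le> 4 * circle_mean (\<lambda>w. cmod (f w)) z"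
proof -
  let ?c = "maclaurin_coeff f"
  define r where "r = cmod z"
  \<comment> \<open>The direction of z; as sgn 0 = 0, the value 1 is inserted at the origin to keep
    modulus one.\<close>
  define e where "e = (if z = 0 then 1 else sgn z)"
  have e: "cmod e = 1" "z = of_real r * e"
    by (auto simp: e_def r_def norm_sgn sgn_eq norm_divide)
  define s where "s = (r + 1) / 2"
  have s: "r < s" "s < 1" using z by (auto simp: s_def r_def)
  let ?p = "\<lambda>n w. \<Sum>k\<le>n. ?c k * w ^ k"
  \<comment> \<open>The bound s keeps all radii away from 1, and r + 1 / (n + 1) forces convergence
    to r. A Taylor polynomial that vanishes identically has no zero-free circle; its coefficient sum
    is 0, so any radius serves.\<close>
  have "\<exists>t. r < t \<and> t < min s (r + 1 / (real n + 1)) \<and>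
      ((\<exists>k\<le>n. ?c k \<noteq> 0) \<longrightarrow> (\<forall>w. cmod w = t \<longrightarrow> ?p n w \<noteq> 0))" for n
  proof (cases "\<exists>k\<le>n. ?c k \<noteq> 0")
    case True
    then show ?thesis using ex_radius_avoiding_roots[of r "min s (r + 1 / (real n + 1))" ?c _ n] s by auto
  next
    case False
    moreover have "\<exists>t. r < t \<and> t < min s (r + 1 / (real n + 1))" using s by (intro dense) auto
    ultimately show ?thesis by auto
  qed
  then obtain t where t: "r < t n" "t n < min s (r + 1 / (real n + 1))"
      "(\<exists>k\<le>n. ?c k \<noteq> 0) \<Longrightarrow> cmod w = t n \<Longrightarrow> ?p n w \<noteq> 0" for n w by metis
  have r0: "0 \<le> r" by (simp add: r_def)
  have tn: "cmod (of_real (t n) * e) = t n" for n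
    using t(1)[of n] r0 e by (simp add: norm_mult)
  have "t \<longlonglongrightarrow> r"
  proof (rule tendsto_sandwich[of "\<lambda>_. r" _ _ "\<lambda>n. r + 1 / (real n + 1)"])
    show "(\<lambda>n. r + 1 / (real n + 1)) \<longlonglongrightarrow> r"
      using tendsto_add[OF tendsto_const[of r] LIMSEQ_inverse_real_of_nat] by (simp add: inverse_eq_divide add_ac)
  qed (use t(1,2) in \<open>auto intro!: always_eventually less_imp_le\<close>)
  then have tz: "(\<lambda>n. of_real (t n) * e) \<longlonglongrightarrow> z"
    unfolding e(2) by (intro tendsto_intros)
  have lim: "(\<lambda>n. 4 * circle_mean (\<lambda>w. cmod (?p n w)) (of_real (t n) * e)) \<longlonglongrightarrow> 4 * circle_mean (\<lambda>w. cmod (f w)) z"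
  proof (intro ennreal_tendsto_cmult circle_mean_tendsto[OF f _ tz s(2)])
    show "cmod (of_real (t n) * e) \<le> s" for n using t(2)[of n] unfolding tn by simp
  qed simp
  have fin: "(\<Sum>k\<le>n. ennreal (cmod (?c k) * r ^ k / (real k + 1))) \<le> 4 * circle_mean (\<lambda>w. cmod (?p n w)) (of_real (t n) * e)" for n
  proof (cases "\<exists>k\<le>n. ?c k \<noteq> 0")
    case True
    \<comment> \<open>Radii approaching r from above make this comparison monotone in the right
      direction.\<close>
    have "(\<Sum>k\<le>n. ennreal (cmod (?c k) * r ^ k / (real k + 1))) \<le> (\<Sum>k\<le>n. ennreal (cmod (?c k) * t n ^ k / (real k + 1)))"
      using t(1)[of n] r0 by (intro sum_mono ennreal_leI divide_right_mono mult_left_mono power_mono) auto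
    also have "\<dots> \<le> 4 * circle_mean (\<lambda>w. cmod (?p n w)) (of_real (t n) * e)"
      using hardy_inequality_trig_poly[where a = "of_real (t n) * e" and N = n and c = ?c] t(3)[OF True] unfolding tn by blast
    finally show ?thesis .
  next
    case False
    then have "(\<Sum>k\<le>n. ennreal (cmod (?c k) * r ^ k / (real k + 1))) = 0" by (intro sum.neutral) auto
    then show ?thesis by simp
  qed
  have "(\<lambda>n. \<Sum>k<Suc n. ennreal (cmod (?c k) * r ^ k / (real k + 1))) \<longlonglongrightarrow> (\<Sum>n. ennreal (cmod (?c n) * r ^ n / (real n + 1)))"
    by (intro LIMSEQ_Suc summable_LIMSEQ) simp
  then show ?thesis
    unfolding r_def[symmetric] using fin by (intro LIMSEQ_le[OF _ lim]) (auto simp: lessThan_Suc_atMost)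
qed

section \<open>Integrals over the disc and comparison of the norms\<close>

text \<open>Boxes determine Lebesgue measure, and their measure is a product of side lengths. This
  turns area integrals into iterated real integrals, open to Fubini and one-dimensional
  substitution.\<close>

lemma lborel_complex_eq_distr: "(lborel :: complex measure) = distr (lborel \<Otimes>\<^sub>M lborel) borel (\<lambda>(x, y). Complex x y)"
proof (rule lborel_eqI)
  have meas [measurable]: "(\<lambda>(x, y). Complex x y) \<in> borel_measurable (borel \<Otimes>\<^sub>M borel)"
    unfolding borel_prod Complex_eq case_prod_beta by (intro borel_measurable_continuous_onI continuous_intros)
  fix l u :: complex assume lu: "\<And>b. b \<in> Basis \<Longrightarrow> l \<bullet> b \<le> u \<bullet> b"
  then have le: "Re l \<le> Re u" "Im l \<le> Im u"
    using lu[of 1] lu[of \<i>] by (simp_all add: Basis_complex_def inner_complex_def)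
  have "(\<lambda>(x, y). Complex x y) -` box l u \<inter> space (lborel \<Otimes>\<^sub>M lborel) = {Re l<..<Re u} \<times> {Im l<..<Im u}"
    by (auto simp: in_box_complex_iff space_pair_measure)
  then have "emeasure (distr (lborel \<Otimes>\<^sub>M lborel) borel (\<lambda>(x, y). Complex x y)) (box l u) =
      emeasure (lborel \<Otimes>\<^sub>M lborel) ({Re l<..<Re u} \<times> {Im l<..<Im u})"
    by (subst emeasure_distr) auto
  also have "\<dots> = ennreal (Re u - Re l) * ennreal (Im u - Im l)"
    using le by (subst lborel.emeasure_pair_measure_Times) auto
  also have "\<dots> = (\<Prod>b\<in>Basis. (u - l) \<bullet> b)"
    using le by (simp add: Basis_complex_def inner_complex_def ennreal_mult)
  finally show "emeasure (distr (lborel \<Otimes>\<^sub>M lborel) borel (\<lambda>(x, y). Complex x y)) (box l u) =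
      (\<Prod>b\<in>Basis. (u - l) \<bullet> b)" .
qed simp

lemma measurable_Complex [measurable]:
  assumes "f \<in> borel_measurable M" "g \<in> borel_measurable M"
  shows "(\<lambda>x. Complex (f x) (g x)) \<in> borel_measurable M"
  using assms unfolding Complex_eq by measurable

lemma nn_integral_complex:
  fixes \<phi> :: "complex \<Rightarrow> ennreal"
  assumes [measurable]: "\<phi> \<in> borel_measurable borel"
  shows "(\<integral>\<^sup>+z. \<phi> z \<partial>lborel) = (\<integral>\<^sup>+x. \<integral>\<^sup>+y. \<phi> (Complex x y) \<partial>lborel \<partial>lborel)"
    and "(\<integral>\<^sup>+z. \<phi> z \<partial>lborel) = (\<integral>\<^sup>+y. \<integral>\<^sup>+x. \<phi> (Complex x y) \<partial>lborel \<partial>lborel)"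
proof -
  have "(\<integral>\<^sup>+z. \<phi> z \<partial>lborel) = (\<integral>\<^sup>+p. \<phi> (Complex (fst p) (snd p)) \<partial>(lborel \<Otimes>\<^sub>M lborel))"
    by (subst lborel_complex_eq_distr, subst nn_integral_distr) (auto simp: case_prod_beta)
  then show *: "(\<integral>\<^sup>+z. \<phi> z \<partial>lborel) = (\<integral>\<^sup>+x. \<integral>\<^sup>+y. \<phi> (Complex x y) \<partial>lborel \<partial>lborel)"
    by (simp add: lborel.nn_integral_fst[symmetric])
  show "(\<integral>\<^sup>+z. \<phi> z \<partial>lborel) = (\<integral>\<^sup>+y. \<integral>\<^sup>+x. \<phi> (Complex x y) \<partial>lborel \<partial>lborel)"
    unfolding * by (rule lborel_pair.Fubini'[symmetric]) measurable
qed

text \<open>The rotation is performed as two real affine substitutions, one coordinate at a time,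
  with factors \<bar>c\<bar> and 1 / \<bar>c\<bar> that cancel. Division by c = Re u is the reason
  for excluding Re u = 0.\<close>

lemma nn_integral_rotation_aux:
  fixes \<phi> :: "complex \<Rightarrow> ennreal"
  assumes [measurable]: "\<phi> \<in> borel_measurable borel" and u: "cmod u = 1" "Re u \<noteq> 0"
  shows "(\<integral>\<^sup>+z. \<phi> (u * z) \<partial>lborel) = (\<integral>\<^sup>+z. \<phi> z \<partial>lborel)"
proof -
  define c s where "c = Re u" and "s = Im u"
  have c: "c \<noteq> 0" and cs: "c * c + s * s = 1"
    using u by (auto simp: c_def s_def cmod_def power2_eq_square)
  have uz: "u * Complex x y = Complex (- s * y + c * x) (s * x + c * y)" for x y
    by (simp add: c_def s_def complex_eq_iff)
  \<comment> \<open>By c * c + s * s = 1, the new second coordinate is expressed through the new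
    first coordinate and the old y, ready for the substitution in x.\<close>
  have sc: "s * x + c * y = s / c * (- s * y + c * x) + 1 / c * y" for x y
  proof -
    have "c * (s * x + c * y) = s * (- s * y + c * x) + (c * c + s * s) * y" by (simp add: algebra_simps)
    then show ?thesis using c unfolding cs by (simp add: field_simps)
  qed
  have "(\<integral>\<^sup>+z. \<phi> (u * z) \<partial>lborel) = (\<integral>\<^sup>+y. \<integral>\<^sup>+x. \<phi> (u * Complex x y) \<partial>lborel \<partial>lborel)"
    by (rule nn_integral_complex) simp
  then have "ennreal \<bar>c\<bar> * (\<integral>\<^sup>+z. \<phi> (u * z) \<partial>lborel) = (\<integral>\<^sup>+y. ennreal \<bar>c\<bar> * (\<integral>\<^sup>+x. \<phi> (u * Complex x y) \<partial>lborel) \<partial>lborel)"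
    by (simp add: nn_integral_cmult)
  also have "\<dots> = (\<integral>\<^sup>+y. \<integral>\<^sup>+x. \<phi> (Complex x (s / c * x + 1 / c * y)) \<partial>lborel \<partial>lborel)"
  proof (rule nn_integral_cong)
    fix y
    show "ennreal \<bar>c\<bar> * (\<integral>\<^sup>+x. \<phi> (u * Complex x y) \<partial>lborel) = (\<integral>\<^sup>+x. \<phi> (Complex x (s / c * x + 1 / c * y)) \<partial>lborel)"
      unfolding uz sc
      by (rule nn_integral_real_affine[OF _ c, of "\<lambda>x. \<phi> (Complex x (s / c * x + 1 / c * y))" "- s * y", symmetric]) measurable
  qed
  also have "\<dots> = (\<integral>\<^sup>+x. \<integral>\<^sup>+y. \<phi> (Complex x (s / c * x + 1 / c * y)) \<partial>lborel \<partial>lborel)"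
    by (rule lborel_pair.Fubini') measurable
  also have "\<dots> = (\<integral>\<^sup>+x. ennreal \<bar>c\<bar> * (\<integral>\<^sup>+y. \<phi> (Complex x y) \<partial>lborel) \<partial>lborel)"
  proof (rule nn_integral_cong)
    fix x
    have "ennreal \<bar>c\<bar> * (\<integral>\<^sup>+y. \<phi> (Complex x y) \<partial>lborel) =
        ennreal \<bar>c\<bar> * (ennreal \<bar>1 / c\<bar> * (\<integral>\<^sup>+y. \<phi> (Complex x (s / c * x + 1 / c * y)) \<partial>lborel))"
      by (subst nn_integral_real_affine[of "\<lambda>y. \<phi> (Complex x y)" "1 / c" "s / c * x"]) (use c in auto)
    also have "\<dots> = ennreal (\<bar>c\<bar> * \<bar>1 / c\<bar>) * (\<integral>\<^sup>+y. \<phi> (Complex x (s / c * x + 1 / c * y)) \<partial>lborel)"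
      by (simp only: ennreal_mult abs_ge_zero mult.assoc)
    also have "\<bar>c\<bar> * \<bar>1 / c\<bar> = 1" using c by simp
    finally show "(\<integral>\<^sup>+y. \<phi> (Complex x (s / c * x + 1 / c * y)) \<partial>lborel) = ennreal \<bar>c\<bar> * (\<integral>\<^sup>+y. \<phi> (Complex x y) \<partial>lborel)"
      by simp
  qed
  also have "\<dots> = ennreal \<bar>c\<bar> * (\<integral>\<^sup>+z. \<phi> z \<partial>lborel)"
    by (subst nn_integral_complex(1)) (auto simp: nn_integral_cmult)
  finally show ?thesis
    using c by (simp add: ennreal_mult_cancel_left)
qed

lemma nn_integral_rotation:
  fixes \<phi> :: "complex \<Rightarrow> ennreal"
  assumes [measurable]: "\<phi> \<in> borel_measurable borel" and u: "cmod u = 1"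
  shows "(\<integral>\<^sup>+z. \<phi> (u * z) \<partial>lborel) = (\<integral>\<^sup>+z. \<phi> z \<partial>lborel)"
proof (cases "Re u = 0")
  case True
  \<comment> \<open>A quarter turn is done as two rotations by a square root of u. If Re v were 0,
    then u would be real, hence 0 by Re u = 0, against modulus one.\<close>
  define v where "v = csqrt u"
  have v: "v * v = u" unfolding v_def by (metis power2_csqrt power2_eq_square)
  then have v1: "cmod v = 1"
    using u by (metis abs_norm_cancel norm_mult power2_eq_1_iff power2_eq_square abs_1 abs_minus_cancel)
  have "Re v \<noteq> 0"
  proof
    assume "Re v = 0"
    then have "Re u = - (Im v)\<^sup>2" "Im u = 0" unfolding v[symmetric] by (simp_all add: power2_eq_square)
    with True u show False by (simp add: cmod_def)
  qed
  have "(\<integral>\<^sup>+z. \<phi> (u * z) \<partial>lborel) = (\<integral>\<^sup>+z. \<phi> (v * (v * z)) \<partial>lborel)"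
    unfolding v[symmetric] by (simp add: mult.assoc)
  also have "\<dots> = (\<integral>\<^sup>+z. \<phi> (v * z) \<partial>lborel)"
    using nn_integral_rotation_aux[of "\<lambda>z. \<phi> (v * z)" v] v1 \<open>Re v \<noteq> 0\<close> by simp
  also have "\<dots> = (\<integral>\<^sup>+z. \<phi> z \<partial>lborel)"
    using nn_integral_rotation_aux[of \<phi> v] v1 \<open>Re v \<noteq> 0\<close> by simp
  finally show ?thesis .
qed (use nn_integral_rotation_aux u in simp)

text \<open>The integral is unchanged under each rotation, hence equals its average over all angles;
  Fubini moves that average inside. The function is extended by zero outside the disc, which every
  rotation preserves.\<close>

lemma nn_integral_disc_eq_circle_mean:
  assumes h: "continuous_on (ball 0 1) h"
  shows "(\<integral>\<^sup>+z\<in>ball 0 1. ennreal (h z) \<partial>lborel) = (\<integral>\<^sup>+z\<in>ball 0 1. circle_mean h z \<partial>lborel)"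
proof -
  define \<phi> where "\<phi> z = ennreal (h z) * indicator (ball 0 1) z" for z :: complex
  have "(\<lambda>z. h z * indicator (ball 0 1) z) \<in> borel_measurable borel"
    using borel_measurable_continuous_on_indicator[OF _ h] by (simp add: mult.commute)
  then have "(\<lambda>z. ennreal (h z * indicator (ball 0 1) z)) \<in> borel_measurable borel" by measurable
  also have "(\<lambda>z. ennreal (h z * indicator (ball 0 1) z)) = \<phi>"
    by (auto simp: \<phi>_def fun_eq_iff split: split_indicator)
  finally have [measurable]: "\<phi> \<in> borel_measurable borel" .
  have cism [measurable]: "cis \<in> borel_measurable borel"
    by (intro borel_measurable_continuous_onI continuous_intros)
  have 1: "ennreal (1 / (2 * pi)) * (\<integral>\<^sup>+\<theta>\<in>{0..2*pi}. (a::ennreal) \<partial>lborel) = a" for a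
  proof -
    have "ennreal (1 / (2 * pi)) * (\<integral>\<^sup>+\<theta>\<in>{0..2*pi}. a \<partial>lborel) = ennreal (1 / (2 * pi)) * (a * ennreal (2 * pi))"
      by (simp add: nn_integral_cmult_indicator)
    also have "\<dots> = ennreal (1 / (2 * pi)) * ennreal (2 * pi) * a" by (simp only: mult_ac)
    also have "ennreal (1 / (2 * pi)) * ennreal (2 * pi) = 1"
      by (subst ennreal_mult[symmetric]) auto
    finally show ?thesis by simp
  qed
  have "(\<integral>\<^sup>+z\<in>ball 0 1. ennreal (h z) \<partial>lborel) = (\<integral>\<^sup>+z. \<phi> z \<partial>lborel)" by (simp add: \<phi>_def)
  also have "\<dots> = ennreal (1 / (2 * pi)) * (\<integral>\<^sup>+\<theta>\<in>{0..2*pi}. (\<integral>\<^sup>+z. \<phi> z \<partial>lborel) \<partial>lborel)"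
    by (rule 1[symmetric])
  also have "\<dots> = ennreal (1 / (2 * pi)) * (\<integral>\<^sup>+\<theta>\<in>{0..2*pi}. (\<integral>\<^sup>+z. \<phi> (cis \<theta> * z) \<partial>lborel) \<partial>lborel)"
    by (simp add: nn_integral_rotation)
  also have "\<dots> = ennreal (1 / (2 * pi)) * (\<integral>\<^sup>+\<theta>. (\<integral>\<^sup>+z. \<phi> (cis \<theta> * z) * indicator {0..2*pi} \<theta> \<partial>lborel) \<partial>lborel)"
    by (simp add: nn_integral_multc)
  also have "\<dots> = ennreal (1 / (2 * pi)) * (\<integral>\<^sup>+z. (\<integral>\<^sup>+\<theta>. \<phi> (cis \<theta> * z) * indicator {0..2*pi} \<theta> \<partial>lborel) \<partial>lborel)"
    by (subst lborel_pair.Fubini') auto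
  also have "\<dots> = (\<integral>\<^sup>+z. ennreal (1 / (2 * pi)) * (\<integral>\<^sup>+\<theta>. \<phi> (cis \<theta> * z) * indicator {0..2*pi} \<theta> \<partial>lborel) \<partial>lborel)"
    by (subst nn_integral_cmult) auto
  also have "\<dots> = (\<integral>\<^sup>+z\<in>ball 0 1. circle_mean h z \<partial>lborel)"
    by (intro nn_integral_cong)
       (auto simp: \<phi>_def circle_mean_def norm_mult mult.commute split: split_indicator)
  finally show ?thesis .
qed

lemma emeasure_annulus:
  assumes "0 \<le> s" "s \<le> 1"
  shows "emeasure lborel {z::complex. s \<le> cmod z \<and> cmod z < 1} = ennreal (pi * (1 - s\<^sup>2))"
proof -
  have "{z::complex. s \<le> cmod z \<and> cmod z < 1} = ball 0 1 - ball 0 s" by auto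
  moreover have "emeasure lborel (ball (0::complex) 1 - ball 0 s) =
      emeasure lborel (ball (0::complex) 1) - emeasure lborel (ball (0::complex) s)"
    using assms by (intro emeasure_Diff subset_ball) (simp_all add: emeasure_ball)
  ultimately show ?thesis
    using assms by (simp add: emeasure_ball unit_ball_vol_2 ennreal_minus algebra_simps)
qed

text \<open>Layer-cake argument: for k = m + 1 the power is the integral of (m + 1) * s ^ m over s
  from 0 to cmod z. After Fubini each s contributes the area of the annulus between s and 1, and a
  one-variable integral remains.\<close>

lemma nn_integral_disc_power:
  "(\<integral>\<^sup>+z\<in>ball 0 1. ennreal (cmod z ^ k) \<partial>lborel) = ennreal (2 * pi / (real k + 2))"
proof (cases k)
  case 0
  then show ?thesis using emeasure_ball[of 1 "0::complex"] by (simp add: unit_ball_vol_2)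
next
  case (Suc m)
  let ?w = "\<lambda>s. ennreal ((real m + 1) * s ^ m)"
  have power: "ennreal (r ^ k) = (\<integral>\<^sup>+s. ?w s * indicator {0..r} s \<partial>lborel)" if "0 \<le> r" for r :: real
  proof -
    have "(\<integral>\<^sup>+s. ?w s * indicator {0..r} s \<partial>lborel) = r ^ Suc m - 0 ^ Suc m"
      by (rule nn_integral_FTC_Icc[where F = "\<lambda>s. s ^ Suc m"]) (use that DERIV_pow[of "Suc m"] in \<open>auto simp: add_ac\<close>)
    then show ?thesis by (simp add: Suc)
  qed
  have [measurable]: "ball (0::complex) 1 \<in> sets borel" by simp
  have [measurable]: "Measurable.pred (borel \<Otimes>\<^sub>M borel) (\<lambda>x::real \<times> complex. fst x \<in> {0..cmod (snd x)})"
    by simp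
  have "(\<integral>\<^sup>+z\<in>ball 0 1. ennreal (cmod z ^ k) \<partial>lborel) =
     (\<integral>\<^sup>+z. (\<integral>\<^sup>+s. ?w s * indicator {0..cmod z} s * indicator (ball 0 1) z \<partial>lborel) \<partial>lborel)"
    by (subst power) (auto simp: nn_integral_multc)
  also have "\<dots> = (\<integral>\<^sup>+s. (\<integral>\<^sup>+z. ?w s * indicator {0..cmod z} s * indicator (ball 0 1) z \<partial>lborel) \<partial>lborel)"
    by (rule lborel_pair.Fubini') measurable
  also have "\<dots> = (\<integral>\<^sup>+s. ennreal ((real m + 1) * s ^ m * (pi * (1 - s\<^sup>2))) * indicator {0..1} s \<partial>lborel)"
  proof (rule nn_integral_cong_AE, rule AE_I2)
    fix s :: real
    show "(\<integral>\<^sup>+z. ?w s * indicator {0..cmod z} s * indicator (ball 0 1) z \<partial>lborel) =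
      ennreal ((real m + 1) * s ^ m * (pi * (1 - s\<^sup>2))) * indicator {0..1} s"
    proof (cases "s \<in> {0..1}")
      case True
      have "(\<integral>\<^sup>+z. ?w s * indicator {0..cmod z} s * indicator (ball 0 1) z \<partial>lborel) =
         (\<integral>\<^sup>+z. ?w s * indicator {z::complex. s \<le> cmod z \<and> cmod z < 1} z \<partial>lborel)"
        using True by (intro nn_integral_cong) (auto split: split_indicator)
      also have "\<dots> = ?w s * emeasure lborel {z::complex. s \<le> cmod z \<and> cmod z < 1}"
        by (intro nn_integral_cmult_indicator) auto
      also have "\<dots> = ennreal ((real m + 1) * s ^ m * (pi * (1 - s\<^sup>2)))"
        using True by (subst emeasure_annulus) (auto simp: ennreal_mult power_le_one)
      finally show ?thesis using True by simp
    next
      case False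
      then have "?w s * indicator {0..cmod z} s * indicator (ball 0 1) z = 0" for z :: complex
        by (auto split: split_indicator)
      then have "(\<integral>\<^sup>+z. ?w s * indicator {0..cmod z} s * indicator (ball 0 1) z \<partial>lborel) = (\<integral>\<^sup>+z. 0 \<partial>(lborel :: complex measure))"
        by (intro nn_integral_cong)
      then show ?thesis using False by simp
    qed
  qed
  also have "\<dots> = ennreal (pi * (1 ^ (m + 1) - (real m + 1) / (real m + 3) * 1 ^ (m + 3)) -
      pi * (0 ^ (m + 1) - (real m + 1) / (real m + 3) * 0 ^ (m + 3)))"
  proof (rule nn_integral_FTC_Icc[where F = "\<lambda>s. pi * (s ^ (m + 1) - (real m + 1) / (real m + 3) * s ^ (m + 3))"])
    fix s :: real assume s: "s \<in> {0..1}"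
    show "0 \<le> (real m + 1) * s ^ m * (pi * (1 - s\<^sup>2))" using s by (simp add: power_le_one)
    have "((\<lambda>s. pi * (s ^ Suc m - (real m + 1) / (real m + 3) * s ^ (m + 3))) has_real_derivative
        pi * (real (Suc m) * s ^ (Suc m - 1) - (real m + 1) / (real m + 3) * (real (m + 3) * s ^ (m + 3 - 1)))) (at s)"
      by (auto intro!: derivative_eq_intros simp del: power_Suc)
    moreover have "pi * (real (Suc m) * s ^ (Suc m - 1) - (real m + 1) / (real m + 3) * (real (m + 3) * s ^ (m + 3 - 1))) =
       (real m + 1) * s ^ m * (pi * (1 - s\<^sup>2))"
    proof -
      have "(real m + 1) / (real m + 3) * (real (m + 3) * s ^ (m + 3 - 1)) = (real m + 1) * s ^ (m + 2)"
        by simp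
      then show ?thesis by (simp add: algebra_simps power2_eq_square)
    qed
    ultimately show "((\<lambda>s. pi * (s ^ (m + 1) - (real m + 1) / (real m + 3) * s ^ (m + 3))) has_real_derivative
        (real m + 1) * s ^ m * (pi * (1 - s\<^sup>2))) (at s)"
      by (simp only: Suc_eq_plus1)
  qed auto
  also have "pi * (1 ^ (m + 1) - (real m + 1) / (real m + 3) * 1 ^ (m + 3)) -
      pi * (0 ^ (m + 1) - (real m + 1) / (real m + 3) * 0 ^ (m + 3)) = 2 * pi / (real k + 2)"
  proof -
    have "1 - (real m + 1) / (real m + 3) = 2 / (real m + 3)" by (simp add: field_simps)
    then show ?thesis by (simp add: Suc add_ac power_0_left)
  qed
  finally show ?thesis .
qed

text \<open>The Bergman-space form of Parseval's identity: apply Parseval on the circle through each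
  point and integrate the even powers of cmod z.\<close>

lemma nn_integral_disc_square:
  assumes h: "h holomorphic_on ball 0 1"
  shows "(\<integral>\<^sup>+z\<in>ball 0 1. ennreal ((cmod (h z))\<^sup>2) \<partial>lborel) =
     (\<Sum>n. ennreal ((cmod (maclaurin_coeff h n))\<^sup>2 * pi / (real n + 1)))"
proof -
  have [measurable]: "ball (0::complex) 1 \<in> sets borel" by simp
  have "(\<integral>\<^sup>+z\<in>ball 0 1. ennreal ((cmod (h z))\<^sup>2) \<partial>lborel) =
     (\<integral>\<^sup>+z\<in>ball 0 1. circle_mean (\<lambda>w. (cmod (h w))\<^sup>2) z \<partial>lborel)"
    using h by (intro nn_integral_disc_eq_circle_mean continuous_intros holomorphic_on_imp_continuous_on)
  also have "\<dots> = (\<integral>\<^sup>+z. (\<Sum>n. ennreal ((cmod (maclaurin_coeff h n))\<^sup>2) * (ennreal (cmod z ^ (2 * n)) * indicator (ball 0 1) z)) \<partial>lborel)"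
    by (intro nn_integral_cong)
       (auto simp: parseval[OF h] power_mult_distrib power_mult[symmetric] ennreal_mult mult.commute[of 2] split: split_indicator)
  also have "\<dots> = (\<Sum>n. \<integral>\<^sup>+z. ennreal ((cmod (maclaurin_coeff h n))\<^sup>2) * (ennreal (cmod z ^ (2 * n)) * indicator (ball 0 1) z) \<partial>lborel)"
    by (rule nn_integral_suminf) measurable
  also have "\<dots> = (\<Sum>n. ennreal ((cmod (maclaurin_coeff h n))\<^sup>2) * ennreal (2 * pi / (real (2 * n) + 2)))"
    by (subst nn_integral_cmult) (auto simp: nn_integral_disc_power simp del: of_nat_mult)
  also have "\<dots> = (\<Sum>n. ennreal ((cmod (maclaurin_coeff h n))\<^sup>2 * pi / (real n + 1)))"
  proof (rule suminf_cong)
    fix n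
    have "2 * pi / (real (2 * n) + 2) = pi / (real n + 1)" by (simp add: field_simps)
    then show "ennreal ((cmod (maclaurin_coeff h n))\<^sup>2) * ennreal (2 * pi / (real (2 * n) + 2)) =
       ennreal ((cmod (maclaurin_coeff h n))\<^sup>2 * pi / (real n + 1))"
      by (subst ennreal_mult[symmetric]) auto
  qed
  finally show ?thesis .
qed

section \<open>Domination of the coefficient norm by the circle and area norms\<close>

lemma H1_norm_eq_circle_mean: "H1_norm f = (SUP r\<in>{0<..<1}. circle_mean (\<lambda>w. cmod (f w)) (of_real r))"
  by (simp add: H1_norm_def circle_mean_def)

text \<open>With finitely many terms the limit r \<rightarrow> 1 may be taken termwise. This brings
  estimates inside the disc to the coefficients themselves, without boundary values.\<close>

lemma sum_ennreal_le_of_radial: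
  fixes x :: "nat \<Rightarrow> real"
  assumes bound: "\<And>r. 0 < r \<Longrightarrow> r < 1 \<Longrightarrow> (\<Sum>n<N. ennreal (x n * r ^ n)) \<le> B"
  shows "(\<Sum>n<N. ennreal (x n)) \<le> B"
proof -
  \<comment> \<open>This is 1 - 1 / (m + 2); the shift makes the first radius 1/2 instead of the
    excluded 0.\<close>
  define r where "r m = 1 - inverse (real (Suc m) + 1)" for m
  have r: "0 < r m" "r m < 1" for m by (auto simp: r_def field_simps)
  have "r \<longlonglongrightarrow> 1 - 0"
    unfolding r_def using LIMSEQ_inverse_real_of_nat[THEN LIMSEQ_Suc]
    by (intro tendsto_diff tendsto_const) (simp add: add_ac)
  then have "(\<lambda>m. \<Sum>n<N. ennreal (x n * r m ^ n)) \<longlonglongrightarrow> (\<Sum>n<N. ennreal (x n * 1 ^ n))"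
    by (intro tendsto_sum tendsto_ennrealI tendsto_mult tendsto_power tendsto_const) simp
  then have "(\<Sum>n<N. ennreal (x n * 1 ^ n)) \<le> B"
    using bound r by (intro Lim_bounded[where M = 0 and f = "\<lambda>m. \<Sum>n<N. ennreal (x n * r m ^ n)"]) blast+
  then show ?thesis by (simp only: power_one mult_1_right)
qed

lemma HL1_norm_le_H1_norm:
  assumes f: "f holomorphic_on ball 0 1"
  shows "HL1_norm f \<le> 4 * H1_norm f"
  unfolding HL1_norm_def
proof (rule suminf_le_const)
  fix N
  let ?c = "maclaurin_coeff f"
  show "(\<Sum>n<N. ennreal (cmod (?c n) / (real n + 1))) \<le> 4 * H1_norm f"
  proof (rule sum_ennreal_le_of_radial)
    fix r :: real assume r: "0 < r" "r < 1"
    have "(\<Sum>n<N. ennreal (cmod (?c n) / (real n + 1) * r ^ n)) \<le> (\<Sum>n. ennreal (cmod (?c n) * r ^ n / (real n + 1)))"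
      unfolding times_divide_eq_left by (intro sum_le_suminf) auto
    also have "\<dots> \<le> 4 * circle_mean (\<lambda>w. cmod (f w)) (of_real r)"
    proof -
      have cr: "cmod (of_real r) = r" using r by simp
      then have "cmod (of_real r) < 1" using r by simp
      from hardy_inequality[OF f this] show ?thesis unfolding cr .
    qed
    also have "\<dots> \<le> 4 * H1_norm f"
      unfolding H1_norm_eq_circle_mean using r by (intro mult_left_mono SUP_upper) auto
    finally show "(\<Sum>n<N. ennreal (cmod (?c n) / (real n + 1) * r ^ n)) \<le> 4 * H1_norm f" .
  qed
qed simp

text \<open>Differentiation multiplies a coefficient by n + 1, which cancels the weight in Hardy's
  inequality for the derivative. Integrating the remaining power cmod z ^ n over the disc yields 2 *
  pi / (n + 2), and n + 2 is the weight belonging to index n + 1 of f.\<close>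

lemma HL1_norm_le_D10_norm:
  assumes f: "f holomorphic_on ball 0 1"
  shows "HL1_norm f \<le> 4 * D10_norm f"
proof -
  let ?c = "maclaurin_coeff f"
  let ?I = "\<integral>\<^sup>+z\<in>ball 0 1. ennreal (cmod (deriv f z)) \<partial>lborel"
  have f': "deriv f holomorphic_on ball 0 1" using f by (intro holomorphic_deriv) auto
  have [measurable]: "ball (0::complex) 1 \<in> sets borel" by simp
  \<comment> \<open>Hardy's constant is carried as 1/4 on the series side, so that it is pulled out
    of the integral of an explicit power series, which is visibly measurable.\<close>
  have quarter: "ennreal (1/4) * (4 * x) = x" "4 * (ennreal (1/4) * x) = x" for x
  proof -
    have "ennreal (1/4) * 4 = 1" using ennreal_mult[of "1/4" 4] by simp
    then show "ennreal (1/4) * (4 * x) = x" "4 * (ennreal (1/4) * x) = x"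
      by (metis mult.assoc mult_1, metis mult.assoc mult.commute mult_1)
  qed
  have le: "x \<le> 4 * x" "x \<le> 2 * x" for x :: ennreal
    using mult_right_mono[of 1 4 x] mult_right_mono[of 1 2 x] by simp_all
  have "2 * ennreal pi * (\<Sum>n. ennreal (cmod (?c (Suc n)) / (real (Suc n) + 1))) =
      (\<Sum>n. ennreal (cmod (?c (Suc n))) * ennreal (2 * pi / (real n + 2)))"
  proof (subst ennreal_suminf_cmult[symmetric], rule suminf_cong)
    fix n
    have "2 * ennreal pi = ennreal (2 * pi)" by (simp add: ennreal_mult)
    then show "2 * ennreal pi * ennreal (cmod (?c (Suc n)) / (real (Suc n) + 1)) =
        ennreal (cmod (?c (Suc n))) * ennreal (2 * pi / (real n + 2))"
      by (simp add: ennreal_mult[symmetric] mult_ac add_ac)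
  qed
  also have "\<dots> = (\<Sum>n. \<integral>\<^sup>+z. ennreal (cmod (?c (Suc n))) * (ennreal (cmod z ^ n) * indicator (ball 0 1) z) \<partial>lborel)"
  proof (rule suminf_cong)
    fix n
    have [measurable]: "(\<lambda>z::complex. ennreal (cmod z ^ n) * indicator (ball 0 1) z) \<in> borel_measurable lborel"
      by measurable
    show "ennreal (cmod (?c (Suc n))) * ennreal (2 * pi / (real n + 2)) =
        (\<integral>\<^sup>+z. ennreal (cmod (?c (Suc n))) * (ennreal (cmod z ^ n) * indicator (ball 0 1) z) \<partial>lborel)"
      by (simp add: nn_integral_cmult nn_integral_disc_power)
  qed
  also have "\<dots> = (\<integral>\<^sup>+z. (\<Sum>n. ennreal (cmod (?c (Suc n))) * (ennreal (cmod z ^ n) * indicator (ball 0 1) z)) \<partial>lborel)"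
    by (rule nn_integral_suminf[symmetric]) measurable
  finally have "ennreal (1/4) * (2 * ennreal pi * (\<Sum>n. ennreal (cmod (?c (Suc n)) / (real (Suc n) + 1)))) =
      ennreal (1/4) * (\<integral>\<^sup>+z. (\<Sum>n. ennreal (cmod (?c (Suc n))) * (ennreal (cmod z ^ n) * indicator (ball 0 1) z)) \<partial>lborel)"
    by (rule arg_cong)
  also have "\<dots> = (\<integral>\<^sup>+z. ennreal (1/4) * (\<Sum>n. ennreal (cmod (?c (Suc n))) * (ennreal (cmod z ^ n) * indicator (ball 0 1) z)) \<partial>lborel)"
    by (rule nn_integral_cmult[symmetric]) measurable
  also have "\<dots> \<le> (\<integral>\<^sup>+z\<in>ball 0 1. circle_mean (\<lambda>w. cmod (deriv f w)) z \<partial>lborel)"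
  proof (rule nn_integral_mono)
    fix z :: complex
    show "ennreal (1/4) * (\<Sum>n. ennreal (cmod (?c (Suc n))) * (ennreal (cmod z ^ n) * indicator (ball 0 1) z)) \<le>
       circle_mean (\<lambda>w. cmod (deriv f w)) z * indicator (ball 0 1) z"
    proof (cases "cmod z < 1")
      case True
      have "ennreal (cmod (?c (Suc n))) * ennreal (cmod z ^ n) =
          ennreal (cmod (maclaurin_coeff (deriv f) n) * cmod z ^ n / (real n + 1))" for n
      proof -
        have "cmod (maclaurin_coeff (deriv f) n) = (real n + 1) * cmod (?c (Suc n))"
          unfolding maclaurin_coeff_deriv norm_mult norm_of_nat by simp
        then show ?thesis by (simp add: ennreal_mult[symmetric])
      qed
      then have "(\<Sum>n. ennreal (cmod (?c (Suc n))) * (ennreal (cmod z ^ n) * indicator (ball 0 1) z)) \<le>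
          4 * circle_mean (\<lambda>w. cmod (deriv f w)) z"
        using hardy_inequality[OF f' True] True by simp
      from mult_left_mono[OF this, of "ennreal (1/4)"] show ?thesis
        using True by (simp add: quarter(1))
    qed simp
  qed
  also have "\<dots> = ?I"
    using holomorphic_on_imp_continuous_on[OF f']
    by (intro nn_integral_disc_eq_circle_mean[symmetric] continuous_intros)
  finally have "4 * (ennreal (1/4) * (2 * ennreal pi * (\<Sum>n. ennreal (cmod (?c (Suc n)) / (real (Suc n) + 1))))) \<le> 4 * ?I"
    by (rule mult_left_mono) simp
  then have "2 * ennreal pi * (\<Sum>n. ennreal (cmod (?c (Suc n)) / (real (Suc n) + 1))) \<le> 4 * ?I"
    by (simp only: quarter(2))
  then have "ennreal (1 / pi) * (2 * ennreal pi * (\<Sum>n. ennreal (cmod (?c (Suc n)) / (real (Suc n) + 1)))) \<le> ennreal (1 / pi) * (4 * ?I)"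
    by (rule mult_left_mono) simp
  also have "ennreal (1 / pi) * (2 * ennreal pi * (\<Sum>n. ennreal (cmod (?c (Suc n)) / (real (Suc n) + 1)))) =
     (ennreal (1 / pi) * ennreal pi) * (2 * (\<Sum>n. ennreal (cmod (?c (Suc n)) / (real (Suc n) + 1))))"
    by (simp only: mult_ac)
  also have "ennreal (1 / pi) * ennreal pi = 1"
    by (subst ennreal_mult[symmetric]) auto
  finally have *: "2 * (\<Sum>n. ennreal (cmod (?c (Suc n)) / (real (Suc n) + 1))) \<le> 4 * (ennreal (1 / pi) * ?I)"
    by (simp only: mult_1 mult_ac)
  have "HL1_norm f = ennreal (cmod (f 0)) + (\<Sum>n. ennreal (cmod (?c (Suc n)) / (real (Suc n) + 1)))"
    unfolding HL1_norm_def
    by (subst suminf_ennreal_split_head) (simp add: maclaurin_coeff_0)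
  \<comment> \<open>The estimates give 1 for the value at 0 and 2 for the integral; both are
    weakened to 4, the constant shared with \<open>H1_norm\<close>.\<close>
  also have "\<dots> \<le> 4 * ennreal (cmod (f 0)) + 2 * (\<Sum>n. ennreal (cmod (?c (Suc n)) / (real (Suc n) + 1)))"
    by (intro add_mono le)
  also have "\<dots> \<le> 4 * ennreal (cmod (f 0)) + 4 * (ennreal (1 / pi) * ?I)"
    by (intro add_mono * order_refl)
  finally show ?thesis
    by (simp add: D10_norm_def distrib_left add.commute)
qed

section \<open>The test functions\<close>

text \<open>The Szego kernel of the disc at the real point \<rho>.\<close>

definition geom_kernel :: "real \<Rightarrow> complex \<Rightarrow> complex" where
  "geom_kernel \<rho> z = 1 / (1 - of_real \<rho> * z)"

context
  fixes \<rho> :: real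
  assumes \<rho>: "0 \<le> \<rho>" "\<rho> < 1"
begin

lemma geom_kernel_denominator:
  assumes "cmod z < 1"
  shows "1 - \<rho> \<le> cmod (1 - of_real \<rho> * z)" "1 - of_real \<rho> * z \<noteq> 0"
proof -
  have "cmod (of_real \<rho> * z) \<le> \<rho>" using assms \<rho> by (simp add: norm_mult mult_left_le)
  then show "1 - \<rho> \<le> cmod (1 - of_real \<rho> * z)"
    using norm_triangle_ineq2[of 1 "of_real \<rho> * z"] by simp
  then show "1 - of_real \<rho> * z \<noteq> 0" using \<rho> by auto
qed

lemma holomorphic_geom_kernel [holomorphic_intros]: "geom_kernel \<rho> holomorphic_on ball 0 1"
  unfolding geom_kernel_def using geom_kernel_denominator(2) by (intro holomorphic_intros) auto

lemma norm_geom_kernel_le: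
  assumes "cmod z < 1"
  shows "cmod (geom_kernel \<rho> z) \<le> 1 / (1 - \<rho>)"
  unfolding geom_kernel_def norm_divide norm_one
  using geom_kernel_denominator[OF assms] \<rho> by (intro divide_left_mono mult_pos_pos) auto

lemma has_field_derivative_geom_kernel:
  assumes "cmod z < 1"
  shows "(geom_kernel \<rho> has_field_derivative of_real \<rho> * (geom_kernel \<rho> z)\<^sup>2) (at z)"
proof -
  have "((\<lambda>z. 1 - of_real \<rho> * z) has_field_derivative - of_real \<rho>) (at z)"
    by (auto intro!: derivative_eq_intros)
  from DERIV_inverse'[OF this geom_kernel_denominator(2)[OF assms]] show ?thesis
    by (simp add: geom_kernel_def [abs_def] power2_eq_square divide_inverse mult_ac)
qed

lemma maclaurin_coeff_geom_kernel: "maclaurin_coeff (geom_kernel \<rho>) n = of_real (\<rho> ^ n)"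
proof (rule maclaurin_coeff_eqI)
  fix z :: complex assume "cmod z < 1"
  then have "cmod (of_real \<rho> * z) \<le> \<rho>" using \<rho> by (simp add: norm_mult mult_left_le)
  then have "cmod (of_real \<rho> * z) < 1" using \<rho>(2) by (rule order.strict_trans1)
  from geometric_sums[OF this] show "(\<lambda>n. of_real (\<rho> ^ n) * z ^ n) sums geom_kernel \<rho> z"
    by (simp add: geom_kernel_def power_mult_distrib)
qed simp

lemma maclaurin_coeff_geom_kernel_2:
  "maclaurin_coeff (\<lambda>z. geom_kernel \<rho> z * geom_kernel \<rho> z) n = of_real ((real n + 1) * \<rho> ^ n)"
proof -
  have "maclaurin_coeff (\<lambda>z. geom_kernel \<rho> z * geom_kernel \<rho> z) n = (\<Sum>i\<le>n. of_real (\<rho> ^ i) * of_real (\<rho> ^ (n - i)))"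
    by (subst maclaurin_coeff_mult[of _ 1]) (auto intro!: holomorphic_intros simp: maclaurin_coeff_geom_kernel)
  also have "\<dots> = (\<Sum>i\<le>n. of_real (\<rho> ^ n))"
    by (intro sum.cong refl) (simp flip: of_real_mult power_add)
  finally show ?thesis by simp
qed

lemma maclaurin_coeff_geom_kernel_3:
  "maclaurin_coeff (\<lambda>z. geom_kernel \<rho> z * (geom_kernel \<rho> z * geom_kernel \<rho> z)) n =
     of_real ((real n + 1) * (real n + 2) / 2 * \<rho> ^ n)"
proof -
  have "maclaurin_coeff (\<lambda>z. geom_kernel \<rho> z * (geom_kernel \<rho> z * geom_kernel \<rho> z)) n =
      (\<Sum>i\<le>n. of_real (\<rho> ^ i) * of_real ((real (n - i) + 1) * \<rho> ^ (n - i)))"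
    by (subst maclaurin_coeff_mult[of _ 1])
       (auto intro!: holomorphic_intros simp: maclaurin_coeff_geom_kernel maclaurin_coeff_geom_kernel_2)
  also have "\<dots> = (\<Sum>i\<le>n. of_real ((real (n - i) + 1) * \<rho> ^ n))"
  proof (intro sum.cong refl)
    fix i assume "i \<in> {..n}"
    then have "\<rho> ^ n = \<rho> ^ i * \<rho> ^ (n - i)" by (simp flip: power_add)
    then show "complex_of_real (\<rho> ^ i) * of_real ((real (n - i) + 1) * \<rho> ^ (n - i)) = of_real ((real (n - i) + 1) * \<rho> ^ n)"
      by simp
  qed
  also have "\<dots> = of_real ((\<Sum>i\<le>n. real (n - i) + 1) * \<rho> ^ n)"
    by (simp only: sum_distrib_right of_real_sum)
  also have "(\<Sum>i\<le>n. real (n - i) + 1) = (\<Sum>i\<le>n. real i + 1)"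
    by (rule sum.reindex_bij_witness[of _ "\<lambda>i. n - i" "\<lambda>i. n - i"]) auto
  also have "\<dots> = (real n + 1) * (real n + 2) / 2"
    by (induction n) (auto simp: field_simps)
  finally show ?thesis .
qed

lemma circle_mean_geom_kernel_le:
  assumes "cmod z < 1"
  shows "circle_mean (\<lambda>w. (cmod (geom_kernel \<rho> w))\<^sup>2) z \<le> ennreal (1 / (1 - \<rho>))"
proof -
  have "circle_mean (\<lambda>w. (cmod (geom_kernel \<rho> w))\<^sup>2) z = (\<Sum>n. ennreal ((\<rho> ^ n * cmod z ^ n)\<^sup>2))"
    using \<rho> assms by (subst parseval[OF holomorphic_geom_kernel]) (auto simp: maclaurin_coeff_geom_kernel norm_power)
  \<comment> \<open>Discarding a factor at most 1 from each term costs less than a factor 2 at the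
    limit radius 1 and leaves a bound independent of z.\<close>
  also have "\<dots> \<le> (\<Sum>n. ennreal (\<rho> ^ n))"
  proof (intro suminf_le ennreal_leI)
    fix n
    have "\<rho> ^ n * cmod z ^ n \<le> \<rho> ^ n * 1" "\<rho> ^ n \<le> 1"
      using assms \<rho> by (intro mult_left_mono power_le_one; simp)+
    then have "(\<rho> ^ n * cmod z ^ n) * (\<rho> ^ n * cmod z ^ n) \<le> \<rho> ^ n * 1"
      using \<rho> by (intro mult_mono) auto
    then show "(\<rho> ^ n * cmod z ^ n)\<^sup>2 \<le> \<rho> ^ n" by (simp add: power2_eq_square)
  qed auto
  also have "\<dots> = ennreal (1 / (1 - \<rho>))"
    using \<rho> by (intro suminf_ennreal_eq geometric_sums) auto
  finally show ?thesis .
qed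

lemma disc_integral_geom_kernel_4_le:
  "(\<integral>\<^sup>+z\<in>ball 0 1. ennreal (cmod (geom_kernel \<rho> z) ^ 4) \<partial>lborel) \<le> ennreal (pi / (1 - \<rho>)\<^sup>2)"
proof -
  have "(\<integral>\<^sup>+z\<in>ball 0 1. ennreal (cmod (geom_kernel \<rho> z) ^ 4) \<partial>lborel) =
      (\<integral>\<^sup>+z\<in>ball 0 1. ennreal ((cmod (geom_kernel \<rho> z * geom_kernel \<rho> z))\<^sup>2) \<partial>lborel)"
    by (simp add: norm_mult power2_eq_square numeral_eq_Suc mult.assoc)
  also have "\<dots> = (\<Sum>n. ennreal ((cmod (of_real ((real n + 1) * \<rho> ^ n)))\<^sup>2 * pi / (real n + 1)))"
    unfolding maclaurin_coeff_geom_kernel_2[symmetric]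
    by (intro nn_integral_disc_square holomorphic_intros)
  also have "\<dots> \<le> (\<Sum>n. ennreal (pi * ((real n + 1) * \<rho> ^ n)))"
  proof (intro suminf_le ennreal_leI)
    fix n
    have "(cmod (of_real ((real n + 1) * \<rho> ^ n)))\<^sup>2 * pi / (real n + 1) = pi * ((real n + 1) * (\<rho> ^ n * \<rho> ^ n))"
      unfolding norm_of_real by (simp add: power2_eq_square divide_simps)
    also have "\<rho> ^ n * \<rho> ^ n \<le> \<rho> ^ n * 1"
      using \<rho> by (intro mult_left_mono power_le_one) auto
    finally show "(cmod (of_real ((real n + 1) * \<rho> ^ n)))\<^sup>2 * pi / (real n + 1) \<le> pi * ((real n + 1) * \<rho> ^ n)"
      by (simp add: mult_left_mono)
  qed auto
  also have "\<dots> = ennreal (pi * (1 / (1 - \<rho>)\<^sup>2))"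
    using geometric_deriv_sums[of \<rho>] \<rho>
    by (intro suminf_ennreal_eq sums_mult) (auto simp: add_ac)
  finally show ?thesis by simp
qed

text \<open>The factor 1/4 puts the function in all three unit balls: the \<open>D10\<close> norm is
  at most 3/4 from the derivative plus 1/4 from the origin, and the \<open>H1\<close> norm is at
  most 1/4, which Hardy's constant 4 turns into 1 for \<open>HL1\<close>.\<close>

definition test_function :: "complex \<Rightarrow> complex" where
  "test_function z = of_real ((1 - \<rho>)\<^sup>2 / 4) * (geom_kernel \<rho> z * (geom_kernel \<rho> z * geom_kernel \<rho> z))"

lemma holomorphic_test_function: "test_function holomorphic_on ball 0 1"
  unfolding test_function_def by (intro holomorphic_intros)

lemma maclaurin_coeff_test_function:
  "maclaurin_coeff test_function n = of_real ((1 - \<rho>)\<^sup>2 * (real n + 1) * (real n + 2) * \<rho> ^ n / 8)"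
proof -
  have "maclaurin_coeff test_function n = of_real ((1 - \<rho>)\<^sup>2 / 4) * of_real ((real n + 1) * (real n + 2) / 2 * \<rho> ^ n)"
    unfolding maclaurin_coeff_geom_kernel_3[symmetric]
  proof (rule maclaurin_coeff_eqI)
    fix z :: complex assume "cmod z < 1"
    then show "(\<lambda>n. of_real ((1 - \<rho>)\<^sup>2 / 4) * maclaurin_coeff (\<lambda>z. geom_kernel \<rho> z * (geom_kernel \<rho> z * geom_kernel \<rho> z)) n * z ^ n) sums test_function z"
      unfolding test_function_def mult.assoc[of "of_real ((1 - \<rho>)\<^sup>2 / 4)"]
      by (intro sums_mult maclaurin_coeff_sums[of _ 1] holomorphic_intros)
  qed simp
  also have "\<dots> = of_real ((1 - \<rho>)\<^sup>2 / 4 * ((real n + 1) * (real n + 2) / 2 * \<rho> ^ n))"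
    by (rule of_real_mult[symmetric])
  also have "(1 - \<rho>)\<^sup>2 / 4 * ((real n + 1) * (real n + 2) / 2 * \<rho> ^ n) = (1 - \<rho>)\<^sup>2 * (real n + 1) * (real n + 2) * \<rho> ^ n / 8"
    by simp
  finally show ?thesis .
qed

text \<open>One of the three kernel factors is bounded by 1 / (1 - \<rho>); the mean of the other
  two is a square mean, again at most 1 / (1 - \<rho>).\<close>

lemma H1_norm_test_function: "H1_norm test_function \<le> ennreal (1/4)"
  unfolding H1_norm_eq_circle_mean
proof (rule SUP_least)
  fix r :: real assume r: "r \<in> {0<..<1}"
  have "circle_mean (\<lambda>w. cmod (test_function w)) (of_real r) \<le>
    ennreal ((1 - \<rho>) / 4) * circle_mean (\<lambda>w. (cmod (geom_kernel \<rho> w))\<^sup>2) (of_real r)"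
  proof -
    have [measurable]: "geom_kernel \<rho> \<in> borel_measurable borel" "cis \<in> borel_measurable borel"
      unfolding geom_kernel_def [abs_def]
      by (measurable, auto intro!: borel_measurable_continuous_onI continuous_intros)
    have "cmod (test_function (of_real r * cis \<theta>)) \<le> (1 - \<rho>) / 4 * (cmod (geom_kernel \<rho> (of_real r * cis \<theta>)))\<^sup>2" for \<theta>
    proof -
      define a where "a = cmod (geom_kernel \<rho> (of_real r * cis \<theta>))"
      have a: "a \<le> 1 / (1 - \<rho>)"
        unfolding a_def using r by (intro norm_geom_kernel_le) (simp add: norm_mult)
      have "cmod (test_function (of_real r * cis \<theta>)) = (1 - \<rho>)\<^sup>2 / 4 * a\<^sup>2 * a"
        unfolding test_function_def norm_mult norm_of_real a_def by (simp add: power2_eq_square)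
      also have "\<dots> \<le> (1 - \<rho>)\<^sup>2 / 4 * a\<^sup>2 * (1 / (1 - \<rho>))"
        using a by (rule mult_left_mono) simp
      also have "\<dots> = (1 - \<rho>) / 4 * a\<^sup>2"
      proof -
        have "d\<^sup>2 / 4 * a\<^sup>2 * (1 / d) = d / 4 * a\<^sup>2" if "d \<noteq> 0" for d :: real
          using that by (simp add: power2_eq_square)
        from this[of "1 - \<rho>"] show ?thesis using \<rho> by argo
      qed
      finally show ?thesis by (simp add: a_def)
    qed
    then have "(\<integral>\<^sup>+\<theta>\<in>{0..2*pi}. ennreal (cmod (test_function (of_real r * cis \<theta>))) \<partial>lborel) \<le>
        (\<integral>\<^sup>+\<theta>. ennreal ((1 - \<rho>) / 4) * (ennreal ((cmod (geom_kernel \<rho> (of_real r * cis \<theta>)))\<^sup>2) * indicator {0..2*pi} \<theta>) \<partial>lborel)"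
      using \<rho> by (intro nn_integral_mono) (auto simp flip: ennreal_mult split: split_indicator intro!: ennreal_leI)
    also have "\<dots> = ennreal ((1 - \<rho>) / 4) * (\<integral>\<^sup>+\<theta>\<in>{0..2*pi}. ennreal ((cmod (geom_kernel \<rho> (of_real r * cis \<theta>)))\<^sup>2) \<partial>lborel)"
      by (rule nn_integral_cmult) measurable
    finally have "circle_mean (\<lambda>w. cmod (test_function w)) (of_real r) \<le>
        ennreal (1 / (2 * pi)) * (ennreal ((1 - \<rho>) / 4) * (\<integral>\<^sup>+\<theta>\<in>{0..2*pi}. ennreal ((cmod (geom_kernel \<rho> (of_real r * cis \<theta>)))\<^sup>2) \<partial>lborel))"
      unfolding circle_mean_def by (rule mult_left_mono) simp
    then show ?thesis unfolding circle_mean_def by (simp only: mult_ac)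
  qed
  also have "\<dots> \<le> ennreal ((1 - \<rho>) / 4) * ennreal (1 / (1 - \<rho>))"
    using r by (intro mult_left_mono circle_mean_geom_kernel_le) auto
  also have "\<dots> = ennreal (1/4)"
    using \<rho> by (subst ennreal_mult[symmetric]) auto
  finally show "circle_mean (\<lambda>w. cmod (test_function w)) (of_real r) \<le> ennreal (1/4)" .
qed

lemma D10_norm_test_function: "D10_norm test_function \<le> 1"
proof -
  have d: "cmod (deriv test_function z) \<le> 3 / 4 * (1 - \<rho>)\<^sup>2 * cmod (geom_kernel \<rho> z) ^ 4" if z: "cmod z < 1" for z
  proof -
    define a where "a = cmod (geom_kernel \<rho> z)"
    \<comment> \<open>The kernel K satisfies K' = \<rho> * K^2, so the derivative of its cube is 3 *
      \<rho> * K^4.\<close>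
    have "(test_function has_field_derivative of_real ((1 - \<rho>)\<^sup>2 / 4) * (3 * of_real \<rho> * geom_kernel \<rho> z ^ 4)) (at z)"
      unfolding test_function_def [abs_def]
      by (auto intro!: derivative_eq_intros has_field_derivative_geom_kernel[OF z] simp: power2_eq_square numeral_eq_Suc)
    note eq = DERIV_imp_deriv[OF this]
    have "cmod (deriv test_function z) = (1 - \<rho>)\<^sup>2 / 4 * (3 * \<rho> * a ^ 4)"
      using \<rho> unfolding eq norm_mult norm_power norm_of_real a_def by simp
    also have "\<dots> \<le> (1 - \<rho>)\<^sup>2 / 4 * (3 * 1 * a ^ 4)"
      using \<rho> by (intro mult_left_mono mult_right_mono) (auto simp: a_def)
    finally show ?thesis by (simp add: a_def)
  qed
  have [measurable]: "geom_kernel \<rho> \<in> borel_measurable borel" "ball (0::complex) 1 \<in> sets borel"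
    unfolding geom_kernel_def [abs_def] by measurable
  have "(\<integral>\<^sup>+z\<in>ball 0 1. ennreal (cmod (deriv test_function z)) \<partial>lborel) \<le>
      (\<integral>\<^sup>+z. ennreal (3 / 4 * (1 - \<rho>)\<^sup>2) * (ennreal (cmod (geom_kernel \<rho> z) ^ 4) * indicator (ball 0 1) z) \<partial>lborel)"
    using d by (intro nn_integral_mono) (auto simp flip: ennreal_mult split: split_indicator intro!: ennreal_leI)
  also have "\<dots> = ennreal (3 / 4 * (1 - \<rho>)\<^sup>2) * (\<integral>\<^sup>+z\<in>ball 0 1. ennreal (cmod (geom_kernel \<rho> z) ^ 4) \<partial>lborel)"
    by (rule nn_integral_cmult) measurable
  also have "\<dots> \<le> ennreal (3 / 4 * (1 - \<rho>)\<^sup>2) * ennreal (pi / (1 - \<rho>)\<^sup>2)"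
    by (intro mult_left_mono disc_integral_geom_kernel_4_le) simp
  also have "\<dots> = ennreal (3 / 4 * pi)"
    using \<rho> by (subst ennreal_mult[symmetric]) auto
  finally have "ennreal (1 / pi) * (\<integral>\<^sup>+z\<in>ball 0 1. ennreal (cmod (deriv test_function z)) \<partial>lborel) \<le>
      ennreal (1 / pi) * ennreal (3 / 4 * pi)"
    by (rule mult_left_mono) simp
  also have "\<dots> = ennreal (3 / 4)"
    by (subst ennreal_mult[symmetric]) auto
  finally have 1: "ennreal (1 / pi) * (\<integral>\<^sup>+z\<in>ball 0 1. ennreal (cmod (deriv test_function z)) \<partial>lborel) \<le> ennreal (3 / 4)" .
  have "cmod (test_function 0) = (1 - \<rho>)\<^sup>2 / 4"
    unfolding test_function_def norm_mult norm_of_real by (simp add: geom_kernel_def)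
  also have "\<dots> \<le> 1 / 4"
    using \<rho> by (simp add: power_le_one)
  finally have 2: "ennreal (cmod (test_function 0)) \<le> ennreal (1 / 4)" by (rule ennreal_leI)
  have "D10_norm test_function \<le> ennreal (3 / 4) + ennreal (1 / 4)"
    unfolding D10_norm_def by (rule add_mono[OF 1 2])
  also have "\<dots> = 1" by (subst ennreal_plus[symmetric]) auto
  finally show ?thesis .
qed

end

section \<open>The integral operator\<close>

lemma T_op_has_field_derivative:
  assumes f: "f holomorphic_on ball 0 1" and g: "g holomorphic_on ball 0 1" and z: "z \<in> ball 0 1"
  shows "(T_op g f has_field_derivative f z * deriv g z) (at z)"
proof -
  have "(\<lambda>z. f z * deriv g z) holomorphic_on ball 0 1"
    using f g by (intro holomorphic_intros holomorphic_deriv) auto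
  then obtain P where P': "\<And>w. w \<in> ball 0 1 \<Longrightarrow> (P has_field_derivative f w * deriv g w) (at w within ball 0 1)"
    by (rule holomorphic_convex_primitive'[rotated 2]) auto
  have P: "(P has_field_derivative f w * deriv g w) (at w)" if "w \<in> ball 0 1" for w
    using P'[OF that] that by (simp only: at_within_open open_ball)
  have "T_op g f w = P w - P 0" if w: "w \<in> ball 0 1" for w
  proof -
    have "closed_segment 0 w \<subseteq> ball 0 1" using w by (intro closed_segment_subset) auto
    then have "((\<lambda>z. f z * deriv g z) has_contour_integral P w - P 0) (linepath 0 w)"
      using contour_integral_primitive[OF P', of "linepath 0 w"] by simp
    then show ?thesis unfolding T_op_def by (rule contour_integral_unique)
  qed
  moreover have "((\<lambda>w. P w - P 0) has_field_derivative f z * deriv g z) (at z)"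
    using DERIV_diff[OF P[OF z] DERIV_const[of "P 0"]] by simp
  ultimately show ?thesis
    using z by (intro has_field_derivative_transform_within_open[of "\<lambda>w. P w - P 0" _ z "ball 0 1" "T_op g f"]) simp_all
qed

lemma holomorphic_T_op:
  assumes "f holomorphic_on ball 0 1" "g holomorphic_on ball 0 1"
  shows "T_op g f holomorphic_on ball 0 1"
proof (rule holomorphic_onI)
  fix z :: complex assume "z \<in> ball 0 1"
  then have "T_op g f field_differentiable at z"
    unfolding field_differentiable_def by (intro exI[of _ "f z * deriv g z"] T_op_has_field_derivative[OF assms])
  then show "T_op g f field_differentiable at z within ball 0 1"
    by (rule field_differentiable_at_within)
qed

text \<open>Functions are total, and the identity between the derivative of \<open>T_op g f\<close>
  and its integrand is available only on the disc.\<close>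

lemma maclaurin_coeff_cong:
  assumes f: "f holomorphic_on ball 0 r" and r: "r > 0" and eq: "\<And>z. z \<in> ball 0 r \<Longrightarrow> f z = g z"
  shows "maclaurin_coeff g n = maclaurin_coeff f n"
proof (rule maclaurin_coeff_eqI[OF r])
  fix z :: complex assume "cmod z < r"
  then show "(\<lambda>n. maclaurin_coeff f n * z ^ n) sums g z"
    using maclaurin_coeff_sums[OF f, of z] eq[of z] by simp
qed

lemma maclaurin_coeff_T_op:
  assumes f: "f holomorphic_on ball 0 1" and g: "g holomorphic_on ball 0 1"
  shows "maclaurin_coeff (T_op g f) 0 = 0"
    and "maclaurin_coeff (T_op g f) (Suc m) = maclaurin_coeff (\<lambda>z. f z * deriv g z) m / of_nat (Suc m)"
proof -
  show "maclaurin_coeff (T_op g f) 0 = 0"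
    by (simp add: maclaurin_coeff_0 T_op_def)
  have "maclaurin_coeff (\<lambda>z. f z * deriv g z) m = maclaurin_coeff (deriv (T_op g f)) m"
  proof (rule maclaurin_coeff_cong)
    show "deriv (T_op g f) holomorphic_on ball 0 1"
      using holomorphic_T_op[OF f g] by (intro holomorphic_deriv) auto
    show "deriv (T_op g f) z = f z * deriv g z" if "z \<in> ball 0 1" for z
      using T_op_has_field_derivative[OF f g that] by (rule DERIV_imp_deriv)
  qed simp
  then show "maclaurin_coeff (T_op g f) (Suc m) = maclaurin_coeff (\<lambda>z. f z * deriv g z) m / of_nat (Suc m)"
    unfolding maclaurin_coeff_deriv by (simp del: of_nat_Suc)
qed

section \<open>Supremum norms, coefficient sums and two-sided estimates for the operator\<close>

lemma Hinf_norm_le_suminf_maclaurin_coeff: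
  assumes f: "f holomorphic_on ball 0 1"
  shows "Hinf_norm f \<le> (\<Sum>n. ennreal (cmod (maclaurin_coeff f n)))"
  unfolding Hinf_norm_def
proof (rule SUP_least)
  fix z :: complex assume z: "z \<in> ball 0 1"
  let ?c = "maclaurin_coeff f"
  have summ: "summable (\<lambda>n. cmod (?c n) * cmod z ^ n)"
    using z by (intro summable_norm_maclaurin_coeff[OF f]) auto
  have "f z = (\<Sum>n. ?c n * z ^ n)"
    using maclaurin_coeff_sums[OF f, of z] z by (simp add: sums_iff)
  then have "cmod (f z) \<le> (\<Sum>n. cmod (?c n) * cmod z ^ n)"
    using summable_norm[of "\<lambda>n. ?c n * z ^ n"] summ by (simp add: norm_mult norm_power)
  then have "ennreal (cmod (f z)) \<le> ennreal (\<Sum>n. cmod (?c n) * cmod z ^ n)" by (rule ennreal_leI)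
  also have "\<dots> = (\<Sum>n. ennreal (cmod (?c n) * cmod z ^ n))"
    using summ by (intro suminf_ennreal2[symmetric]) auto
  also have "\<dots> \<le> (\<Sum>n. ennreal (cmod (?c n)))"
    using z by (intro suminf_le ennreal_leI mult_left_le power_le_one) auto
  finally show "ennreal (cmod (f z)) \<le> (\<Sum>n. ennreal (cmod (?c n)))" .
qed

text \<open>At a point r of the positive radius nothing cancels: f r is the sum of the moduli of the
  coefficients times r ^ n.\<close>

lemma suminf_maclaurin_coeff_le_Hinf_norm:
  assumes f: "f holomorphic_on ball 0 1" and nonneg: "\<And>n. maclaurin_coeff f n \<in> \<real>\<^sub>\<ge>\<^sub>0"
  shows "(\<Sum>n. ennreal (cmod (maclaurin_coeff f n))) \<le> Hinf_norm f"
proof (rule suminf_le_const)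
  fix N
  let ?c = "maclaurin_coeff f"
  show "(\<Sum>n<N. ennreal (cmod (?c n))) \<le> Hinf_norm f"
  proof (rule sum_ennreal_le_of_radial)
    fix r :: real assume r: "0 < r" "r < 1"
    have "summable (\<lambda>n. cmod (?c n) * r ^ n)"
      using r by (intro summable_norm_maclaurin_coeff[OF f]) auto
    then have le: "(\<Sum>n<N. cmod (?c n) * r ^ n) \<le> (\<Sum>n. cmod (?c n) * r ^ n)"
      using r by (intro sum_le_suminf) auto
    have c: "?c n = of_real (cmod (?c n))" for n
      using nonneg[of n] by (auto elim!: nonneg_Reals_cases)
    have "(\<lambda>n. ?c n * of_real r ^ n) sums f (of_real r)"
      using r by (intro maclaurin_coeff_sums[OF f]) simp
    then have "(\<lambda>n. of_real (cmod (?c n)) * of_real r ^ n) sums f (of_real r)"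
      by (simp only: c[symmetric])
    then have "(\<lambda>n. of_real (cmod (?c n) * r ^ n)) sums f (of_real r)"
      by (simp only: of_real_mult of_real_power)
    from sums_Re[OF this] have "(\<Sum>n. cmod (?c n) * r ^ n) = Re (f (of_real r))"
      by (simp only: Re_complex_of_real sums_iff)
    also have "\<dots> \<le> cmod (f (of_real r))" by (rule complex_Re_le_cmod)
    finally have "ennreal (\<Sum>n<N. cmod (?c n) * r ^ n) \<le> ennreal (cmod (f (of_real r)))"
      using le by (intro ennreal_leI) linarith
    also have "\<dots> \<le> Hinf_norm f"
      unfolding Hinf_norm_def using r by (intro SUP_upper) simp
    also have "ennreal (\<Sum>n<N. cmod (?c n) * r ^ n) = (\<Sum>n<N. ennreal (cmod (?c n) * r ^ n))"
      using r by (intro sum_ennreal[symmetric]) simp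
    finally show "(\<Sum>n<N. ennreal (cmod (?c n) * r ^ n)) \<le> Hinf_norm f" .
  qed
qed simp

text \<open>The sum of the coefficient moduli of the operator applied to the monomial z ^ k. Moduli
  of the coefficients of g' replace the real parts in \<open>coeff_sup\<close>, to fit the norm
  estimates.\<close>

definition coeff_tail :: "(complex \<Rightarrow> complex) \<Rightarrow> nat \<Rightarrow> ennreal" where
  "coeff_tail g k = (\<Sum>n. ennreal (cmod (maclaurin_coeff (deriv g) n)) * ennreal (1 / (real (n + k) + 1)))"

lemma coeff_sup_eq_coeff_tail:
  assumes "\<And>n. maclaurin_coeff g n \<in> \<real>\<^sub>\<ge>\<^sub>0"
  shows "coeff_sup g = (SUP k. ennreal (real k + 1) * coeff_tail g k)"
proof -
  have "ennreal ((real n + 1) * Re (maclaurin_coeff g (n + 1)) / (real n + real k + 1)) =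
      ennreal (cmod (maclaurin_coeff (deriv g) n)) * ennreal (1 / (real (n + k) + 1))" for n k
  proof -
    have "Re (maclaurin_coeff g (Suc n)) = cmod (maclaurin_coeff g (Suc n))"
      using assms[of "Suc n"] by (auto elim!: nonneg_Reals_cases)
    then have "cmod (maclaurin_coeff (deriv g) n) = (real n + 1) * Re (maclaurin_coeff g (n + 1))"
      unfolding maclaurin_coeff_deriv norm_mult norm_of_nat by simp
    moreover have "ennreal (cmod (maclaurin_coeff (deriv g) n)) * ennreal (1 / (real (n + k) + 1)) =
        ennreal (cmod (maclaurin_coeff (deriv g) n) * (1 / (real (n + k) + 1)))"
      by (rule ennreal_mult[symmetric]) auto
    ultimately show ?thesis by simp
  qed
  then show ?thesis unfolding coeff_sup_def coeff_tail_def by presburger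
qed

lemma Hinf_norm_T_op_le:
  assumes f: "f holomorphic_on ball 0 1" and g: "g holomorphic_on ball 0 1"
    and nonneg: "\<And>n. maclaurin_coeff g n \<in> \<real>\<^sub>\<ge>\<^sub>0"
  shows "Hinf_norm (T_op g f) \<le> coeff_sup g * HL1_norm f"
proof -
  have g': "deriv g holomorphic_on ball 0 1" using g by (intro holomorphic_deriv) auto
  have "Hinf_norm (T_op g f) \<le> (\<Sum>n. ennreal (cmod (maclaurin_coeff (T_op g f) n)))"
    by (rule Hinf_norm_le_suminf_maclaurin_coeff[OF holomorphic_T_op[OF f g]])
  also have "\<dots> = (\<Sum>m. ennreal (cmod (maclaurin_coeff (\<lambda>z. f z * deriv g z) m) / (real m + 1)))"
    unfolding suminf_ennreal_split_head[of "\<lambda>n. ennreal (cmod (maclaurin_coeff (T_op g f) n))"]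
      maclaurin_coeff_T_op[OF f g] norm_divide norm_of_nat by (simp add: add_ac)
  also have "\<dots> \<le> (\<Sum>i. ennreal (cmod (maclaurin_coeff f i)) * coeff_tail g i)"
    unfolding coeff_tail_def
    by (intro suminf_convolution_weighted_le maclaurin_coeff_mult_norm_le[OF f g']) simp
  also have "\<dots> \<le> (\<Sum>i. coeff_sup g * ennreal (cmod (maclaurin_coeff f i) / (real i + 1)))"
  proof (rule suminf_le)
    fix i
    \<comment> \<open>Inserting i + 1 separates the \<open>HL1\<close> term from the factor that
      \<open>coeff_sup\<close> controls.\<close>
    have "ennreal (cmod (maclaurin_coeff f i)) = ennreal (cmod (maclaurin_coeff f i) / (real i + 1)) * ennreal (real i + 1)"
      by (subst ennreal_mult[symmetric]) auto
    then have "ennreal (cmod (maclaurin_coeff f i)) * coeff_tail g i =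
        ennreal (cmod (maclaurin_coeff f i) / (real i + 1)) * (ennreal (real i + 1) * coeff_tail g i)"
      by (simp only: mult.assoc)
    also have "\<dots> \<le> ennreal (cmod (maclaurin_coeff f i) / (real i + 1)) * coeff_sup g"
      unfolding coeff_sup_eq_coeff_tail[OF nonneg] by (intro mult_left_mono SUP_upper) auto
    finally show "ennreal (cmod (maclaurin_coeff f i)) * coeff_tail g i \<le>
        coeff_sup g * ennreal (cmod (maclaurin_coeff f i) / (real i + 1))"
      by (simp only: mult.commute)
  qed auto
  also have "\<dots> = coeff_sup g * HL1_norm f"
    unfolding HL1_norm_def by (rule ennreal_suminf_cmult)
  finally show ?thesis .
qed

text \<open>With nonnegative coefficients the supremum norm is at least the full sum of
  \<open>coeff_tail g i\<close> weighted by the coefficients of f. Dropping the indices above k and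
  using that \<open>coeff_tail g\<close> is decreasing leaves a product.\<close>

lemma le_Hinf_norm_T_op:
  assumes f: "f holomorphic_on ball 0 1" and g: "g holomorphic_on ball 0 1"
    and fnonneg: "\<And>n. maclaurin_coeff f n \<in> \<real>\<^sub>\<ge>\<^sub>0" and gnonneg: "\<And>n. maclaurin_coeff g n \<in> \<real>\<^sub>\<ge>\<^sub>0"
  shows "(\<Sum>i\<le>k. ennreal (cmod (maclaurin_coeff f i))) * coeff_tail g k \<le> Hinf_norm (T_op g f)"
proof -
  let ?a = "\<lambda>i. cmod (maclaurin_coeff f i)" and ?b = "\<lambda>n. cmod (maclaurin_coeff (deriv g) n)"
  let ?h = "\<lambda>z. f z * deriv g z"
  have g': "deriv g holomorphic_on ball 0 1" using g by (intro holomorphic_deriv) auto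
  have fa: "maclaurin_coeff f i = of_real (?a i)" for i
    using fnonneg[of i] by (auto elim!: nonneg_Reals_cases)
  have gb: "maclaurin_coeff (deriv g) n = of_real (?b n)" for n
  proof -
    obtain x where "maclaurin_coeff g (Suc n) = of_real x" "x \<ge> 0"
      using gnonneg[of "Suc n"] by (auto elim!: nonneg_Reals_cases)
    then have "maclaurin_coeff (deriv g) n = of_real (real (Suc n) * x)" "0 \<le> real (Suc n) * x"
      by (simp_all add: maclaurin_coeff_deriv del: of_nat_Suc)
    then show ?thesis by (simp only: norm_of_real abs_of_nonneg)
  qed
  have h: "maclaurin_coeff ?h m = of_real (\<Sum>i\<le>m. ?a i * ?b (m - i))" for m
  proof -
    have "maclaurin_coeff ?h m = (\<Sum>i\<le>m. maclaurin_coeff f i * maclaurin_coeff (deriv g) (m - i))"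
      by (rule maclaurin_coeff_mult[OF f g']) simp
    also have "\<dots> = (\<Sum>i\<le>m. of_real (?a i) * of_real (?b (m - i)))"
      by (simp only: fa[symmetric] gb[symmetric])
    also have "\<dots> = of_real (\<Sum>i\<le>m. ?a i * ?b (m - i))"
      by (simp only: of_real_mult of_real_sum)
    finally show ?thesis .
  qed
  have T: "maclaurin_coeff (T_op g f) (Suc m) = of_real ((\<Sum>i\<le>m. ?a i * ?b (m - i)) / (real m + 1))" for m
    unfolding maclaurin_coeff_T_op(2)[OF f g] h by (simp add: add_ac)
  have Tnn: "0 \<le> (\<Sum>i\<le>m. ?a i * ?b (m - i)) / (real m + 1)" for m
    by (intro divide_nonneg_nonneg sum_nonneg) auto
  have nonneg: "maclaurin_coeff (T_op g f) n \<in> \<real>\<^sub>\<ge>\<^sub>0" for n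
  proof (cases n)
    case 0
    then show ?thesis by (simp add: maclaurin_coeff_T_op(1)[OF f g])
  next
    case (Suc m)
    then show ?thesis using T[of m] Tnn[of m] by (simp only: nonneg_Reals_of_real_iff)
  qed
  have "(\<Sum>i\<le>k. ennreal (?a i)) * coeff_tail g k = (\<Sum>i\<le>k. ennreal (?a i) * coeff_tail g k)"
    by (rule sum_distrib_right)
  also have "\<dots> \<le> (\<Sum>i\<le>k. ennreal (?a i) * coeff_tail g i)"
    unfolding coeff_tail_def
    by (intro sum_mono mult_left_mono suminf_le ennreal_leI divide_left_mono) auto
  also have "\<dots> \<le> (\<Sum>i. ennreal (?a i) * coeff_tail g i)"
    by (intro sum_le_suminf) auto
  also have "\<dots> = (\<Sum>m. (\<Sum>i\<le>m. ennreal (?a i) * ennreal (?b (m - i))) * ennreal (1 / (real m + 1)))"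
    unfolding coeff_tail_def
    by (rule suminf_ennreal_convolution[of "\<lambda>i. ennreal (?a i)" "\<lambda>n. ennreal (?b n)" "\<lambda>m. ennreal (1 / (real m + 1))", symmetric])
  also have "\<dots> = (\<Sum>m. ennreal (cmod (maclaurin_coeff (T_op g f) (Suc m))))"
  proof (rule suminf_cong)
    fix m
    have "(\<Sum>i\<le>m. ennreal (?a i) * ennreal (?b (m - i))) = ennreal (\<Sum>i\<le>m. ?a i * ?b (m - i))"
      by (simp flip: ennreal_mult)
    also have "\<dots> * ennreal (1 / (real m + 1)) = ennreal ((\<Sum>i\<le>m. ?a i * ?b (m - i)) * (1 / (real m + 1)))"
      by (intro ennreal_mult[symmetric] sum_nonneg) auto
    also have "\<dots> = ennreal (cmod (maclaurin_coeff (T_op g f) (Suc m)))"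
      unfolding T norm_of_real abs_of_nonneg[OF Tnn] by simp
    finally show "(\<Sum>i\<le>m. ennreal (?a i) * ennreal (?b (m - i))) * ennreal (1 / (real m + 1)) =
        ennreal (cmod (maclaurin_coeff (T_op g f) (Suc m)))" .
  qed
  also have "\<dots> = (\<Sum>n. ennreal (cmod (maclaurin_coeff (T_op g f) n)))"
    unfolding suminf_ennreal_split_head[of "\<lambda>n. ennreal (cmod (maclaurin_coeff (T_op g f) n))"]
      maclaurin_coeff_T_op(1)[OF f g] by simp
  also have "\<dots> \<le> Hinf_norm (T_op g f)"
    by (rule suminf_maclaurin_coeff_le_Hinf_norm[OF holomorphic_T_op[OF f g] nonneg])
  finally show ?thesis .
qed

lemma sum_coeff_test_function_ge:
  defines "\<rho> \<equiv> \<lambda>k. 1 - 1 / (2 * (real k + 1))"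
  shows "ennreal (real k + 1) \<le> 192 * (\<Sum>i\<le>k. ennreal (cmod (maclaurin_coeff (test_function (\<rho> k)) i)))"
proof -
  let ?d = "1 / (2 * (real k + 1))"
  have \<rho>: "0 \<le> \<rho> k" "\<rho> k < 1" by (auto simp: \<rho>_def field_simps)
  have coeff: "cmod (maclaurin_coeff (test_function (\<rho> k)) i) = ?d\<^sup>2 * (real i + 1) * (real i + 2) * \<rho> k ^ i / 8" for i
    unfolding maclaurin_coeff_test_function[OF \<rho>] norm_of_real
    using \<rho> by (subst abs_of_nonneg) (simp_all add: \<rho>_def)
  \<comment> \<open>By Bernoulli's inequality; the factor 2 in the choice of \<rho> makes k * (1 -
    \<rho>) at most 1/2.\<close>
  have half: "1 / 2 \<le> \<rho> k ^ i" if "i \<le> k" for i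
  proof -
    have "real i * ?d \<le> real k * ?d" using that by (intro mult_right_mono) auto
    also have "\<dots> \<le> 1 / 2" by (simp add: field_simps)
    finally have "1 / 2 \<le> 1 + real i * (- ?d)" by simp
    also have "\<dots> \<le> (1 + (- ?d)) ^ i" by (rule Bernoulli_inequality) (simp add: field_simps)
    finally show ?thesis by (simp add: \<rho>_def)
  qed
  have sum: "(\<Sum>i\<le>n. (real i + 1) * (real i + 2)) = (real n + 1) * (real n + 2) * (real n + 3) / 3" for n
    by (induction n) (auto simp: field_simps)
  \<comment> \<open>Origin of 192 = 4 * 16 * 3: the 4 from squaring 1 / (2 * (k + 1)), the 16 from
    the 8 in the coefficients and the bound 1/2 for the powers of \<rho>, the 3 from summing (i + 1)
    * (i + 2).\<close>
  have "real k + 1 = 192 * (?d\<^sup>2 / 16 * ((real k + 1) * (real k + 1) * (real k + 1) / 3))"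
  proof -
    have "x = 192 * ((1 / (2 * x))\<^sup>2 / 16 * (x * x * x / 3))" if "x \<noteq> 0" for x :: real
      using that by (simp add: power2_eq_square)
    moreover have "real k + 1 \<noteq> 0" by linarith
    ultimately show ?thesis .
  qed
  also have "\<dots> \<le> 192 * (?d\<^sup>2 / 16 * ((real k + 1) * (real k + 2) * (real k + 3) / 3))"
    by (intro mult_left_mono divide_right_mono mult_mono) auto
  also have "\<dots> = 192 * (\<Sum>i\<le>k. ?d\<^sup>2 / 16 * ((real i + 1) * (real i + 2)))"
    by (simp only: sum sum_distrib_left[symmetric])
  also have "\<dots> \<le> 192 * (\<Sum>i\<le>k. cmod (maclaurin_coeff (test_function (\<rho> k)) i))"
  proof (intro mult_left_mono sum_mono)
    fix i assume "i \<in> {..k}"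
    then have "?d\<^sup>2 / 8 * ((real i + 1) * (real i + 2)) * (1 / 2) \<le> ?d\<^sup>2 / 8 * ((real i + 1) * (real i + 2)) * \<rho> k ^ i"
      by (intro mult_left_mono half) auto
    then show "?d\<^sup>2 / 16 * ((real i + 1) * (real i + 2)) \<le> cmod (maclaurin_coeff (test_function (\<rho> k)) i)"
      unfolding coeff by (simp only: mult_ac times_divide_eq_left times_divide_eq_right)
  qed simp
  finally have "ennreal (real k + 1) \<le> ennreal (192 * (\<Sum>i\<le>k. cmod (maclaurin_coeff (test_function (\<rho> k)) i)))"
    by (rule ennreal_leI)
  also have "\<dots> = 192 * (\<Sum>i\<le>k. ennreal (cmod (maclaurin_coeff (test_function (\<rho> k)) i)))"
    by (subst ennreal_mult) (auto intro: sum_nonneg)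
  finally show ?thesis .
qed

lemma coeff_tail_le_Hinf_norm_T_op:
  assumes N: "N \<in> {H1_norm, D10_norm, HL1_norm}"
    and g: "g holomorphic_on ball 0 1" and nonneg: "\<And>n. maclaurin_coeff g n \<in> \<real>\<^sub>\<ge>\<^sub>0"
  shows "\<exists>f\<in>analytic_space N. N f \<le> 1 \<and> ennreal (real k + 1) * coeff_tail g k \<le> 192 * Hinf_norm (T_op g f)"
proof -
  define \<rho> where "\<rho> = 1 - 1 / (2 * (real k + 1))"
  have \<rho>: "0 \<le> \<rho>" "\<rho> < 1" by (auto simp: \<rho>_def field_simps)
  let ?f = "test_function \<rho>"
  note f = holomorphic_test_function[OF \<rho>]
  have H1: "H1_norm ?f \<le> ennreal (1/4)" by (rule H1_norm_test_function[OF \<rho>])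
  also have "ennreal (1/4) \<le> ennreal 1" by (rule ennreal_leI) simp
  finally have H1': "H1_norm ?f \<le> 1" by simp
  \<comment> \<open>The third norm follows from the \<open>H1\<close> estimate by Hardy's
    inequality.\<close>
  have "HL1_norm ?f \<le> 4 * ennreal (1/4)"
    using order_trans[OF HL1_norm_le_H1_norm[OF f] mult_left_mono[OF H1]] by simp
  also have "\<dots> = 1" using ennreal_mult[of 4 "1/4"] by simp
  finally have "N ?f \<le> 1"
    using N H1' D10_norm_test_function[OF \<rho>] by auto
  moreover from this have "?f \<in> analytic_space N"
    unfolding analytic_space_def using f by (auto intro: order.strict_trans1)
  moreover have "ennreal (real k + 1) * coeff_tail g k \<le> 192 * Hinf_norm (T_op g ?f)"
  proof -
    have "ennreal (real k + 1) * coeff_tail g k \<le>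
        192 * (\<Sum>i\<le>k. ennreal (cmod (maclaurin_coeff ?f i))) * coeff_tail g k"
      unfolding \<rho>_def by (rule mult_right_mono[OF sum_coeff_test_function_ge]) simp
    also have "\<dots> = 192 * ((\<Sum>i\<le>k. ennreal (cmod (maclaurin_coeff ?f i))) * coeff_tail g k)"
      by (rule mult.assoc)
    also have "\<dots> \<le> 192 * Hinf_norm (T_op g ?f)"
    proof (intro mult_left_mono le_Hinf_norm_T_op f g nonneg)
      show "maclaurin_coeff ?f n \<in> \<real>\<^sub>\<ge>\<^sub>0" for n
        unfolding maclaurin_coeff_test_function[OF \<rho>] nonneg_Reals_of_real_iff using \<rho> by simp
    qed simp
    finally show ?thesis .
  qed
  ultimately show ?thesis by blast
qed

section \<open>Operator norm bounds with constants common to the three spaces\<close>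

lemma HL1_norm_le:
  assumes "N \<in> {H1_norm, D10_norm, HL1_norm}" "f holomorphic_on ball 0 1"
  shows "HL1_norm f \<le> 4 * N f"
proof -
  have "1 * HL1_norm f \<le> 4 * HL1_norm f" by (rule mult_right_mono) simp_all
  then show ?thesis
    using assms HL1_norm_le_H1_norm[of f] HL1_norm_le_D10_norm[of f] by auto
qed

context
  fixes N g
  assumes N: "N \<in> {H1_norm, D10_norm, HL1_norm}"
    and g: "g holomorphic_on ball 0 1" and nonneg: "\<And>n. maclaurin_coeff g n \<in> \<real>\<^sub>\<ge>\<^sub>0"
begin

lemma Hinf_norm_T_op_le_4:
  assumes "f \<in> analytic_space N"
  shows "Hinf_norm (T_op g f) \<le> 4 * coeff_sup g * N f"
proof -
  have f: "f holomorphic_on ball 0 1" using assms by (simp add: analytic_space_def)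
  have "Hinf_norm (T_op g f) \<le> coeff_sup g * HL1_norm f"
    by (rule Hinf_norm_T_op_le[OF f g nonneg])
  also have "\<dots> \<le> coeff_sup g * (4 * N f)"
    by (rule mult_left_mono[OF HL1_norm_le[OF N f]]) simp
  finally show ?thesis by (simp only: mult_ac)
qed

lemma bounded_T_op:
  assumes "coeff_sup g < \<infinity>"
  shows "bounded_operator N Hinf_norm (T_op g)"
  unfolding bounded_operator_def
proof (intro conjI ballI exI)
  \<comment> \<open>Boundedness asks for a real constant; finiteness of \<open>coeff_sup g\<close>
    makes the conversion exact.\<close>
  have C: "ennreal (enn2real (4 * coeff_sup g)) = 4 * coeff_sup g"
    using assms by (intro ennreal_enn2real) (simp add: ennreal_mult_less_top)
  fix f assume f: "f \<in> analytic_space N"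
  show le: "Hinf_norm (T_op g f) \<le> ennreal (enn2real (4 * coeff_sup g)) * N f"
    unfolding C by (rule Hinf_norm_T_op_le_4[OF f])
  have "ennreal (enn2real (4 * coeff_sup g)) * N f < \<infinity>"
    using f by (simp add: analytic_space_def ennreal_mult_less_top)
  with le show "T_op g f \<in> analytic_space Hinf_norm"
    using f g holomorphic_T_op[of f g] by (auto simp: analytic_space_def)
qed

lemma operator_norm_T_op_le:
  "operator_norm N Hinf_norm (T_op g) \<le> 4 * coeff_sup g"
proof (cases "coeff_sup g < \<infinity>")
  case True
  have "Hinf_norm (T_op g f) \<le> 4 * coeff_sup g" if "f \<in> analytic_space N" "N f \<le> 1" for f
  proof -
    have "4 * coeff_sup g * N f \<le> 4 * coeff_sup g * 1" using that by (intro mult_left_mono) auto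
    with Hinf_norm_T_op_le_4[OF that(1)] show ?thesis by simp
  qed
  then show ?thesis
    using bounded_T_op[OF True] by (auto simp: operator_norm_def intro: SUP_least)
next
  case False
  then have "coeff_sup g = \<infinity>" by (simp add: less_top[symmetric])
  then show ?thesis by (simp add: ennreal_mult_top)
qed

lemma coeff_sup_le_operator_norm:
  "coeff_sup g \<le> 192 * operator_norm N Hinf_norm (T_op g)"
proof (cases "bounded_operator N Hinf_norm (T_op g)")
  case True
  show ?thesis
    unfolding coeff_sup_eq_coeff_tail[OF nonneg]
  proof (rule SUP_least)
    fix k :: nat
    obtain f where f: "f \<in> analytic_space N" "N f \<le> 1"
        "ennreal (real k + 1) * coeff_tail g k \<le> 192 * Hinf_norm (T_op g f)"
      using coeff_tail_le_Hinf_norm_T_op[OF N g nonneg] by blast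
    have "Hinf_norm (T_op g f) \<le> operator_norm N Hinf_norm (T_op g)"
      using True f(1,2) unfolding operator_norm_def by (auto intro: SUP_upper)
    from order_trans[OF f(3) mult_left_mono[OF this]]
    show "ennreal (real k + 1) * coeff_tail g k \<le> 192 * operator_norm N Hinf_norm (T_op g)" by simp
  qed
next
  case False
  then show ?thesis by (simp add: operator_norm_def ennreal_mult_top)
qed

text \<open>For the forward direction, a bounding constant also bounds the operator norm, and
  \<open>coeff_sup_le_operator_norm\<close> passes finiteness on to
  \<open>coeff_sup g\<close>.\<close>

lemma bounded_T_op_iff: "bounded_operator N Hinf_norm (T_op g) \<longleftrightarrow> coeff_sup g < \<infinity>"
proof
  assume bdd: "bounded_operator N Hinf_norm (T_op g)"
  then obtain C where C: "\<And>f. f \<in> analytic_space N \<Longrightarrow> Hinf_norm (T_op g f) \<le> ennreal C * N f"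
    unfolding bounded_operator_def by blast
  have "operator_norm N Hinf_norm (T_op g) \<le> ennreal C"
  proof -
    have "Hinf_norm (T_op g f) \<le> ennreal C" if "f \<in> analytic_space N" "N f \<le> 1" for f
    proof -
      have "ennreal C * N f \<le> ennreal C * 1" using that by (intro mult_left_mono) auto
      with C[OF that(1)] show ?thesis by simp
    qed
    then show ?thesis using bdd by (auto simp: operator_norm_def intro: SUP_least)
  qed
  then have "operator_norm N Hinf_norm (T_op g) < \<infinity>" by (auto intro: order.strict_trans1)
  then show "coeff_sup g < \<infinity>"
    using order.strict_trans1[OF coeff_sup_le_operator_norm] by (simp add: ennreal_mult_less_top)
qed (rule bounded_T_op)

end

theorem theorem3:
  fixes N :: "(complex \<Rightarrow> complex) \<Rightarrow> ennreal"
  assumes "N \<in> {H1_norm, D10_norm, HL1_norm}"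
  shows "(\<forall>g\<in>analytic_space Hinf_norm. (\<forall>n. maclaurin_coeff g n \<in> \<real>\<^sub>\<ge>\<^sub>0) \<longrightarrow>
            (bounded_operator N Hinf_norm (T_op g) \<longleftrightarrow> coeff_sup g < \<infinity>)) \<and>
         (\<exists>C::real. C > 0 \<and>
            (\<forall>g\<in>analytic_space Hinf_norm. (\<forall>n. maclaurin_coeff g n \<in> \<real>\<^sub>\<ge>\<^sub>0) \<longrightarrow>
               ennreal (inverse C) * coeff_sup g \<le> operator_norm N Hinf_norm (T_op g) \<and>
               operator_norm N Hinf_norm (T_op g) \<le> ennreal C * coeff_sup g))"
\<comment> \<open>192 is the larger of the two constants, 4 above and 192 below, so it serves both
  sides.\<close>
proof (intro conjI exI[of _ 192] ballI impI)
  fix g assume g: "g \<in> analytic_space Hinf_norm" and nonneg: "\<forall>n. maclaurin_coeff g n \<in> \<real>\<^sub>\<ge>\<^sub>0"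
  then have hol: "g holomorphic_on ball 0 1" by (simp add: analytic_space_def)
  note facts = assms hol nonneg[rule_format]
  show "bounded_operator N Hinf_norm (T_op g) \<longleftrightarrow> coeff_sup g < \<infinity>"
    by (rule bounded_T_op_iff[OF facts])
  have "ennreal (inverse 192) * coeff_sup g \<le> ennreal (inverse 192) * (192 * operator_norm N Hinf_norm (T_op g))"
    by (intro mult_left_mono coeff_sup_le_operator_norm[OF facts]) simp
  also have "\<dots> = ennreal (inverse 192) * ennreal 192 * operator_norm N Hinf_norm (T_op g)"
    by (simp only: mult.assoc ennreal_numeral)
  also have "ennreal (inverse 192) * ennreal 192 = 1"
    by (subst ennreal_mult[symmetric]) auto
  finally show "ennreal (inverse 192) * coeff_sup g \<le> operator_norm N Hinf_norm (T_op g)"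
    by simp
  have "4 * coeff_sup g \<le> ennreal 192 * coeff_sup g"
    by (intro mult_right_mono) auto
  then show "operator_norm N Hinf_norm (T_op g) \<le> ennreal 192 * coeff_sup g"
    by (rule order_trans[OF operator_norm_T_op_le[OF facts]])
qed simp

end
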